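(* Let $n$ be a cube-free positive integer. Then there do not exist finite groups $G$ and $N$, both of order $n$, such that $G$ is insolvable, $N$ is solvable, and $\mathcal{E}'(G,N)$ is non-empty.
   Context: For a finite group $N$, let $\mathrm{Perm}(N)$ be the group of all permutations of the set $N$. A subgroup $\mathcal{G}\le \mathrm{Perm}(N)$ is regular if the map $\mathcal{G}\to N$, $\sigma\mapsto\sigma(1_N)$, is bijective. Let $\rho:N\to\mathrm{Perm}(N)$, $\rho(\eta)(x)=x\eta^{-1}$. The holomorph of $N$ is $\mathrm{Hol}(N)=\rho(N)\rtimes\mathrm{Aut}(N)\le\mathrm{Perm}(N)$. For a group $G$ with $|G|=|N|$, $\mathcal{E}'(G,N)$ denotes the set of regular subgroups of $\mathrm{Hol}(N)$ isomorphic to $G$. *)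

theory Defs
  imports "HOL-Algebra.Algebra" "HOL-Computational_Algebra.Primes"
begin

text \<open>Perm(N) is realised as BijGroup (carrier N) (extensional bijections of the
carrier of N).  rho(eta)(x) = x eta^{-1}.\<close>

definition rho_perm :: "('c, 'd) monoid_scheme \<Rightarrow> 'c \<Rightarrow> ('c \<Rightarrow> 'c)" where
  "rho_perm N \<eta> = (\<lambda>x \<in> carrier N. x \<otimes>\<^bsub>N\<^esub> inv\<^bsub>N\<^esub> \<eta>)"

definition Hol :: "('c, 'd) monoid_scheme \<Rightarrow> ('c \<Rightarrow> 'c) set" where
  "Hol N = {compose (carrier N) (rho_perm N \<eta>) \<alpha> | \<eta> \<alpha>.
              \<eta> \<in> carrier N \<and> \<alpha> \<in> auto N}"

definition regular_perm_subgroup :: "('c, 'd) monoid_scheme \<Rightarrow> ('c \<Rightarrow> 'c) set \<Rightarrow> bool" where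
  "regular_perm_subgroup N \<G> \<longleftrightarrow>
     subgroup \<G> (BijGroup (carrier N)) \<and>
     bij_betw (\<lambda>\<sigma>. \<sigma> \<one>\<^bsub>N\<^esub>) \<G> (carrier N)"

definition E' :: "('a, 'b) monoid_scheme \<Rightarrow> ('c, 'd) monoid_scheme \<Rightarrow> ('c \<Rightarrow> 'c) set set" where
  "E' G N = {\<G>. \<G> \<subseteq> Hol N \<and> regular_perm_subgroup N \<G> \<and>
                 G \<cong> (BijGroup (carrier N)) \<lparr>carrier := \<G>\<rparr>}"

definition cube_free :: "nat \<Rightarrow> bool" where
  "cube_free n \<longleftrightarrow> (\<forall>p::nat. Factorial_Ring.prime p \<longrightarrow> \<not> p ^ 3 dvd n)"

end

theory Submission
  imports Defs
begin

text \<open>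
A regular subgroup of Hol(N) isomorphic to G amounts to a crossed bijection \<open>\<pi>\<close> from G to N with
respect to an action of G on N by automorphisms, and we induct on the order of N. The subgroup M
of N generated by all commutators and p-th powers is proper for some prime p, is stable under the
action, and its preimage in G is solvable by induction. Since the order is cube-free, V = N/M is
elementary abelian of rank one or two, so only the image L of G in Aut(V) matters. Let C be the
kernel of the action on V. The image of C in V under the induced crossed homomorphism is an
invariant subgroup. If it is trivial, then the square of p divides the order of L, which is
impossible in GL(2,p); if it is a line, then L is triangular; if it is V, then p does not divide
the order of L. In the last case let S be the intersection of L with SL(2,p). Centralizers of
noncentral elements of S are abelian, each has index at most two in its normalizer, and elements
realising index two square to -1. As 8 does not divide the order of S, counting conjugates of
centralizers, as in Dickson's classification, leaves only groups with an abelian normal subgroup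
of index at most two.
\<close>

section \<open>Solvability criteria and conjugation\<close>

text \<open>Crossed bijections are convenient because they restrict to M and its preimage and induce
  a crossed homomorphism into N/M, the two moves of the induction. M is generated by values of
  words, so every endomorphism preserves it, whatever the action is. C is solvable because the
  action disappears on it: there the crossed homomorphism is an ordinary homomorphism into the
  abelian group V, whose kernel lies in the preimage of M. This is why only L has to be studied.
  Cube-freeness enters three times: it bounds the rank of V; it makes p prime to the order of L when
  C maps onto V, since C then already uses up the square of p; and it keeps 8 from dividing the
  order of L. The last use meets the real obstacle: SL(2,5), of order 120 and insolvable, embeds in
  SL(2,11) with order prime to 11, and only the factor 8 rules it out. In the count, a
  self-normalizing centralizer and its conjugates fill at least half of the group and any other at
  least a third, so few classes fit.\<close>

lemma (in group) commutators_imp_solvable_seq: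
  assumes H: "subgroup H G" and K: "solvable_seq G K"
    and comm: "\<And>x y. x \<in> H \<Longrightarrow> y \<in> H \<Longrightarrow> x \<otimes> y \<otimes> inv x \<otimes> inv y \<in> K"
  shows "solvable_seq G H"
proof -
  have Ksub: "subgroup K G" using K solvable_imp_subgroup by blast
  have "derived_set G H \<subseteq> K" using comm by auto
  then have dK: "derived G H \<subseteq> K"
    unfolding derived_def using generate_subgroup_incl Ksub by blast
  obtain n where n: "(derived G ^^ n) K = {\<one>}"
    using solvable_imp_trivial_derived_seq[OF K] by blast
  \<comment> \<open>The derived series of \<open>H\<close> runs at most one step behind that of
    \<open>K\<close>.\<close>
  have "(derived G ^^ Suc n) H \<subseteq> {\<one>}"
    using mono_exp_of_derived[OF dK, of n] n by (simp add: funpow_swap1)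
  moreover have "\<one> \<in> (derived G ^^ Suc n) H"
    using subgroup.one_closed[OF exp_of_derived_is_subgroup[OF H]] .
  ultimately have "(derived G ^^ Suc n) H = {\<one>}" by blast
  then show ?thesis using trivial_derived_seq_imp_solvable[OF H] by blast
qed

lemma (in group) commuting_imp_solvable_seq:
  assumes H: "subgroup H G" and comm: "\<And>x y. x \<in> H \<Longrightarrow> y \<in> H \<Longrightarrow> x \<otimes> y = y \<otimes> x"
  shows "solvable_seq G H"
proof (rule commutators_imp_solvable_seq[OF H solvable_seq.unity])
  fix x y assume "x \<in> H" "y \<in> H"
  then have "x \<in> carrier G" "y \<in> carrier G" "x \<otimes> y = y \<otimes> x"
    using subgroup.subset[OF H] comm by auto
  then show "x \<otimes> y \<otimes> inv x \<otimes> inv y \<in> {\<one>}"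
    by (simp add: m_assoc)
qed

lemma (in group) solvable_subgroup_iff:
  assumes H: "subgroup H G"
  shows "solvable (G\<lparr>carrier := H\<rparr>) \<longleftrightarrow> solvable_seq G H"
proof -
  interpret GH: group "G\<lparr>carrier := H\<rparr>" using subgroup_imp_group[OF H] .
  interpret h: group_hom "G\<lparr>carrier := H\<rparr>" G id
    using H by unfold_locales (auto simp: hom_def subgroup.mem_carrier)
  show ?thesis
  proof
    assume "solvable (G\<lparr>carrier := H\<rparr>)"
    then show "solvable_seq G H"
      using h.solvable_imp_solvable_img[of H] by (simp add: solvable_def)
  next
    assume "solvable_seq G H"
    then show "solvable (G\<lparr>carrier := H\<rparr>)"
      using h.solvable_img_imp_solvable[of H] GH.subgroup_self by (simp add: solvable_def)
  qed
qed

lemma (in group) solvable_seq_mono: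
  assumes "solvable_seq G K" "subgroup H G" "H \<subseteq> K"
  shows "solvable_seq G H"
proof (rule commutators_imp_solvable_seq[OF assms(2,1)])
  fix x y assume "x \<in> H" "y \<in> H"
  then show "x \<otimes> y \<otimes> inv x \<otimes> inv y \<in> K"
    using assms(2,3) by (meson subgroup.m_closed subgroup.m_inv_closed subsetD)
qed

section \<open>Conjugation and centralizers\<close>

definition conjg :: "('a, 'b) monoid_scheme \<Rightarrow> 'a \<Rightarrow> 'a \<Rightarrow> 'a" where
  "conjg G g x = g \<otimes>\<^bsub>G\<^esub> x \<otimes>\<^bsub>G\<^esub> inv\<^bsub>G\<^esub> g"

definition centr :: "('a, 'b) monoid_scheme \<Rightarrow> 'a \<Rightarrow> 'a set" where
  "centr G x = {y \<in> carrier G. y \<otimes>\<^bsub>G\<^esub> x = x \<otimes>\<^bsub>G\<^esub> y}"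

context group
begin

lemma conjg_closed [simp]: "g \<in> carrier G \<Longrightarrow> x \<in> carrier G \<Longrightarrow> conjg G g x \<in> carrier G"
  by (simp add: conjg_def)

lemma conjg_one [simp]: "x \<in> carrier G \<Longrightarrow> conjg G \<one> x = x"
  by (simp add: conjg_def)

text \<open>Reading [u,v] as the factor that turns vu into uv lets multiplicative maps
  (determinants, actions, crossed homomorphisms) be evaluated on commutators without computing
  images of inverses.\<close>

lemma commutator_mult:
  assumes "u \<in> carrier G" "v \<in> carrier G"
  shows "(u \<otimes> v \<otimes> inv u \<otimes> inv v) \<otimes> (v \<otimes> u) = u \<otimes> v"
proof -
  have "(u \<otimes> v \<otimes> inv u \<otimes> inv v) \<otimes> (v \<otimes> u) = u \<otimes> v \<otimes> (inv u \<otimes> ((inv v \<otimes> v) \<otimes> u))"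
    using assms by (simp only: m_assoc m_closed inv_closed)
  then show ?thesis using assms by simp
qed

lemma conjg_mult_self:
  "g \<in> carrier G \<Longrightarrow> x \<in> carrier G \<Longrightarrow> conjg G g x \<otimes> g = g \<otimes> x"
  by (simp add: conjg_def m_assoc)

lemma conjg_mult:
  "g \<in> carrier G \<Longrightarrow> x \<in> carrier G \<Longrightarrow> y \<in> carrier G \<Longrightarrow>
    conjg G g (x \<otimes> y) = conjg G g x \<otimes> conjg G g y"
  by (simp add: conjg_def m_assoc inv_solve_left)

lemma conjg_conjg:
  "g \<in> carrier G \<Longrightarrow> h \<in> carrier G \<Longrightarrow> x \<in> carrier G \<Longrightarrow>
    conjg G g (conjg G h x) = conjg G (g \<otimes> h) x"
  by (simp add: conjg_def m_assoc inv_mult_group)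

lemma conjg_inv_conjg [simp]:
  assumes "g \<in> carrier G" "x \<in> carrier G"
  shows "conjg G (inv g) (conjg G g x) = x" "conjg G g (conjg G (inv g) x) = x"
  using assms by (simp_all add: conjg_conjg)

lemma conjg_eq_iff:
  assumes "g \<in> carrier G" "x \<in> carrier G" "y \<in> carrier G"
  shows "conjg G g x = conjg G g y \<longleftrightarrow> x = y"
  by (metis assms conjg_inv_conjg(1))

lemma centr_subset: "centr G x \<subseteq> carrier G"
  by (auto simp: centr_def)

lemma centr_iff_conjg:
  "x \<in> carrier G \<Longrightarrow> y \<in> centr G x \<longleftrightarrow> y \<in> carrier G \<and> conjg G y x = x"
  by (auto simp: conjg_def centr_def inv_solve_right' inv_solve_right)

lemma centr_sym:
  "x \<in> carrier G \<Longrightarrow> y \<in> carrier G \<Longrightarrow> y \<in> centr G x \<longleftrightarrow> x \<in> centr G y"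
  by (auto simp: centr_def)

lemma centr_conjg:
  assumes "g \<in> carrier G" "x \<in> carrier G" "y \<in> carrier G"
  shows "conjg G g y \<in> centr G (conjg G g x) \<longleftrightarrow> y \<in> centr G x"
  using assms by (simp add: centr_def conjg_mult[symmetric] conjg_eq_iff)

lemma centr_subgroup: "x \<in> carrier G \<Longrightarrow> subgroup (centr G x) G"
proof (rule subgroupI)
  assume x: "x \<in> carrier G"
  show "centr G x \<subseteq> carrier G" by (rule centr_subset)
  show "centr G x \<noteq> {}" using x by (auto simp: centr_def)
  fix a assume "a \<in> centr G x"
  with x show "inv a \<in> centr G x"
    by (metis centr_iff_conjg conjg_inv_conjg(1) inv_closed)
  fix b assume "b \<in> centr G x"
  with x \<open>a \<in> centr G x\<close> show "a \<otimes> b \<in> centr G x"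
    by (simp add: centr_iff_conjg conjg_conjg[symmetric])
qed

lemma card_subgroup_dvd:
  assumes "subgroup H G" "subgroup K G" "H \<subseteq> K"
  shows "card H dvd card K"
proof -
  interpret K: group "G\<lparr>carrier := K\<rparr>" using subgroup_imp_group[OF assms(2)] .
  have "subgroup H (G\<lparr>carrier := K\<rparr>)"
    using assms by (simp add: subgroup_incl)
  from K.lagrange[OF this] show ?thesis by (metis dvd_triv_right order_def partial_object.select_convs(1) partial_object.surjective partial_object.update_convs(1))
qed

end

section \<open>Groups with abelian centralizers: counting conjugates\<close>

text \<open>
  The model is a subgroup of SL(2,p) of order prime to p with Z its scalar matrices. A flip of x is
  an element outside the centralizer of x that normalizes it.
\<close>

locale ca_group = group G for G (structure) +
  fixes Z
  assumes fin: "finite (carrier G)"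
    and Z_subgroup: "subgroup Z G"
    and Z_central: "\<And>z x. z \<in> Z \<Longrightarrow> x \<in> carrier G \<Longrightarrow> z \<otimes> x = x \<otimes> z"
    and Z_card: "card Z \<le> 2"
    and centr_abelian: "\<And>x u v. x \<in> carrier G - Z \<Longrightarrow> u \<in> centr G x \<Longrightarrow> v \<in> centr G x \<Longrightarrow>
          u \<otimes> v = v \<otimes> u"
    and flip_unique: "\<And>x h k. x \<in> carrier G - Z \<Longrightarrow> h \<in> carrier G - centr G x \<Longrightarrow>
          k \<in> carrier G - centr G x \<Longrightarrow> conjg G h x \<in> centr G x \<Longrightarrow> conjg G k x \<in> centr G x \<Longrightarrow>
          conjg G h x = conjg G k x"
    and flip_square: "\<And>x h. x \<in> carrier G - Z \<Longrightarrow> h \<in> carrier G - centr G x \<Longrightarrow>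
          conjg G h x \<in> centr G x \<Longrightarrow> h \<otimes> h \<in> Z - {\<one>}"
    and not_8_dvd: "\<not> 8 dvd order G"
begin

abbreviation "C x \<equiv> centr G x"

text \<open>\<open>nrm x\<close> turns out to be the normalizer of \<open>C x\<close> (see \<open>nrm_C\<close>).\<close>

definition nrm :: "'a \<Rightarrow> 'a set" where
  "nrm x = {h \<in> carrier G. conjg G h x \<in> C x}"

text \<open>The union of all conjugates of \<open>C x\<close>, with \<open>Z\<close> removed. By
  \<open>C_eq\<close> such centralizers meet only in \<open>Z\<close> unless they coincide, so these
  sets partition \<open>carrier G - Z\<close>.\<close>

definition cls :: "'a \<Rightarrow> 'a set" where
  "cls x = (\<lambda>(g, y). conjg G g y) ` (carrier G \<times> (C x - Z))"

lemma Z_subset: "Z \<subseteq> carrier G"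
  using subgroup.subset[OF Z_subgroup] .

lemma fin_Z: "finite Z" and fin_C: "finite (C x)" and fin_cls: "finite (cls x)"
proof -
  show "finite Z" "finite (C x)"
    using fin Z_subset centr_subset[of x] by (auto intro: finite_subset)
  then show "finite (cls x)" using fin by (simp add: cls_def)
qed

lemma Z_subset_C: "x \<in> carrier G \<Longrightarrow> Z \<subseteq> C x"
  using Z_central Z_subset by (auto simp: centr_def)

lemma conjg_Z_iff:
  assumes "g \<in> carrier G" "x \<in> carrier G"
  shows "conjg G g x \<in> Z \<longleftrightarrow> x \<in> Z"
proof -
  have *: "conjg G g x \<in> Z" if "g \<in> carrier G" "x \<in> Z" for g x
    using that Z_central[of x g] Z_subset centr_iff_conjg[of x g] by (auto simp: centr_def)
  show ?thesis using *[of "inv g" "conjg G g x"] *[of g x] assms by auto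
qed

text \<open>Both \<open>C x\<close> and \<open>C y\<close> are abelian and contain x and y; hence
  whatever commutes with one of x and y commutes with the other.\<close>

lemma C_eq:
  assumes "x \<in> carrier G - Z" "y \<in> C x - Z"
  shows "C y = C x"
proof -
  have y: "y \<in> carrier G - Z" using assms(2) centr_subset by blast
  have xy: "x \<in> C y" using assms y centr_sym by blast
  show ?thesis
  proof (intro equalityI subsetI)
    fix u assume "u \<in> C y"
    then show "u \<in> C x" using centr_abelian[OF y _ xy] by (auto simp: centr_def)
  next
    fix u assume "u \<in> C x"
    then show "u \<in> C y" using centr_abelian[OF assms(1), of u y] assms(2) by (auto simp: centr_def)
  qed
qed

text \<open>Conjugation by h carries \<open>C x\<close> to the centralizer of
  \<open>conjg G h x\<close>, which is \<open>C x\<close> again by \<open>C_eq\<close>. Moving the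
  single element x into \<open>C x\<close> therefore already normalizes the whole
  centralizer.\<close>

lemma nrm_C:
  assumes x: "x \<in> carrier G - Z" and h: "h \<in> nrm x" and y: "y \<in> carrier G"
  shows "conjg G h y \<in> C x \<longleftrightarrow> y \<in> C x"
proof -
  have "h \<in> carrier G" "conjg G h x \<in> C x - Z"
    using h x by (auto simp: nrm_def conjg_Z_iff)
  then show ?thesis using C_eq[OF x, of "conjg G h x"] centr_conjg[of h x y] x y by auto
qed

text \<open>Any element of \<open>C x - Z\<close> can replace x as the test element for
  \<open>nrm x\<close>.\<close>

lemma nrmI:
  assumes "x \<in> carrier G - Z" "h \<in> carrier G" "y \<in> C x - Z" "conjg G h y \<in> C x"
  shows "h \<in> nrm x"
proof -
  have y: "y \<in> carrier G" using assms centr_subset by blast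
  have "C (conjg G h y) = C x"
    using C_eq[OF assms(1), of "conjg G h y"] assms y by (auto simp: conjg_Z_iff)
  moreover have "conjg G h x \<in> C (conjg G h y)"
    using assms y centr_conjg[of h y x] centr_sym[of x y] by auto
  ultimately show ?thesis using assms by (auto simp: nrm_def)
qed

lemma C_subset_nrm: "x \<in> carrier G \<Longrightarrow> C x \<subseteq> nrm x"
  by (auto simp: nrm_def centr_iff_conjg) (simp add: conjg_def m_assoc)

lemma nrm_subgroup:
  assumes x: "x \<in> carrier G - Z"
  shows "subgroup (nrm x) G"
proof (rule subgroupI)
  show "nrm x \<subseteq> carrier G" by (auto simp: nrm_def)
  show "nrm x \<noteq> {}" using C_subset_nrm[of x] x by (auto simp: centr_def)
  fix a assume a: "a \<in> nrm x"
  then have ac: "a \<in> carrier G" by (auto simp: nrm_def)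
  have "conjg G (inv a) x \<in> C x"
    using nrm_C[OF x a, of "conjg G (inv a) x"] ac x by (auto simp: centr_def)
  then show "inv a \<in> nrm x" using ac by (simp add: nrm_def)
  fix b assume b: "b \<in> nrm x"
  then show "a \<otimes> b \<in> nrm x"
    using nrm_C[OF x a, of "conjg G b x"] ac x by (auto simp: nrm_def conjg_conjg)
qed

text \<open>Counts the pairs (g, y) with y in \<open>C x - Z\<close> by their conjugate
  \<open>conjg G g y\<close>. The fibre through (g, y) consists of the pairs (gk, y conjugated by
  the inverse of k) with k in \<open>nrm x\<close>, so all fibres have the size of
  \<open>nrm x\<close>. The product form avoids dividing.\<close>

lemma card_cls:
  assumes x: "x \<in> carrier G - Z"
  shows "card (cls x) * card (nrm x) = order G * (card (C x) - card Z)"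
proof -
  let ?P = "carrier G \<times> (C x - Z)" and ?f = "\<lambda>(g, y). conjg G g y"
  have fP: "finite ?P" using fin fin_C by simp
  have fib: "card {q \<in> ?P. ?f q = u} = card (nrm x)" if u: "u \<in> cls x" for u
  proof -
    obtain g y where g: "g \<in> carrier G" and y: "y \<in> C x - Z" and uy: "u = conjg G g y"
      using u by (auto simp: cls_def)
    have yc: "y \<in> carrier G" using y centr_subset by blast
    let ?j = "\<lambda>k. (g \<otimes> k, conjg G (inv k) y)"
    have "bij_betw ?j (nrm x) {q \<in> ?P. ?f q = u}"
    proof (rule bij_betwI')
      fix k l assume "k \<in> nrm x" "l \<in> nrm x"
      then show "(?j k = ?j l) = (k = l)" using g by (auto simp: nrm_def)
    next
      fix k assume k: "k \<in> nrm x"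
      then have kc: "k \<in> carrier G" by (auto simp: nrm_def)
      have "inv k \<in> nrm x" using subgroup.m_inv_closed[OF nrm_subgroup[OF x] k] .
      then have "conjg G (inv k) y \<in> C x - Z"
        using nrm_C[OF x, of "inv k" y] y yc kc by (auto simp: conjg_Z_iff)
      moreover have "conjg G (g \<otimes> k) (conjg G (inv k) y) = u"
        using g kc yc uy by (simp add: conjg_conjg[symmetric])
      ultimately show "?j k \<in> {q \<in> ?P. ?f q = u}" using g kc by auto
    next
      fix q assume "q \<in> {q \<in> ?P. ?f q = u}"
      then obtain h w where q: "q = (h, w)" and h: "h \<in> carrier G" and w: "w \<in> C x - Z"
        and hw: "conjg G h w = u" by auto
      have wc: "w \<in> carrier G" using w centr_subset by blast
      let ?k = "inv g \<otimes> h"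
      have kw: "conjg G ?k w = y"
        using g h wc hw uy yc by (simp add: conjg_conjg[symmetric])
      have "?k \<in> nrm x" using nrmI[OF x _ w] kw y g h by auto
      moreover have "q = ?j ?k"
        using q kw[symmetric] g h wc by (simp add: conjg_inv_conjg m_assoc[symmetric])
      ultimately show "\<exists>k\<in>nrm x. q = ?j k" by blast
    qed
    from bij_betw_same_card[OF this] show ?thesis by simp
  qed
  have "card ?P = (\<Sum>u\<in>?f ` ?P. card {q \<in> ?P. ?f q = u})"
    using sum.image_gen[OF fP, of "\<lambda>_. 1::nat" ?f] by simp
  also have "\<dots> = card (cls x) * card (nrm x)"
    using fib by (simp add: cls_def)
  also have "card ?P = order G * (card (C x) - card Z)"
    using card_Diff_subset[OF fin_Z Z_subset_C] x by (simp add: card_cartesian_product order_def)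
  finally show ?thesis by simp
qed

lemma mem_cls: "x \<in> carrier G - Z \<Longrightarrow> x \<in> cls x"
  unfolding cls_def by (rule image_eqI[of _ _ "(\<one>, x)"]) (auto simp: centr_def)

lemma cls_subset: "cls x \<subseteq> carrier G - Z"
proof
  fix u assume "u \<in> cls x"
  then obtain g y where "g \<in> carrier G" "y \<in> carrier G" "y \<notin> Z" "u = conjg G g y"
    using centr_subset[of x] by (auto simp: cls_def)
  then show "u \<in> carrier G - Z" by (simp add: conjg_Z_iff)
qed

text \<open>A common element provides k with \<open>conjg G k a = b\<close>, and by
  \<open>C_eq\<close> conjugation by k then maps \<open>C x\<close> onto \<open>C y\<close>.
  Equality of the cardinalities later serves to tell classes apart.\<close>

lemma cls_meet:
  assumes x: "x \<in> carrier G - Z" and y: "y \<in> carrier G - Z" and "cls x \<inter> cls y \<noteq> {}"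
  shows "y \<in> cls x" and "card (C x) = card (C y)"
proof -
  obtain g h a b where g: "g \<in> carrier G" and h: "h \<in> carrier G" and a: "a \<in> C x - Z"
    and b: "b \<in> C y - Z" and eq: "conjg G g a = conjg G h b"
    using assms(3) by (auto simp: cls_def)
  define k where "k = inv h \<otimes> g"
  have k: "k \<in> carrier G" using g h by (simp add: k_def)
  have ac: "a \<in> carrier G" "b \<in> carrier G" using a b centr_subset by blast+
  have kab: "conjg G k a = b"
    using g h ac eq by (simp add: k_def conjg_conjg[symmetric])
  have Ca: "C a = C x" and Cb: "C b = C y" using C_eq[OF x a] C_eq[OF y b] by auto
  have *: "conjg G k u \<in> C y \<longleftrightarrow> u \<in> C x" if "u \<in> carrier G" for u
    using centr_conjg[of k a u] k ac that kab Ca Cb by auto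
  have "bij_betw (conjg G k) (C x) (C y)"
  proof (rule bij_betwI')
    fix u v assume "u \<in> C x" "v \<in> C x"
    then show "(conjg G k u = conjg G k v) = (u = v)"
      using k centr_subset conjg_eq_iff by blast
  next
    fix u assume "u \<in> C x" then show "conjg G k u \<in> C y" using * centr_subset by blast
  next
    fix v assume v: "v \<in> C y"
    then have vc: "v \<in> carrier G" using centr_subset by blast
    have "conjg G (inv k) v \<in> C x" using *[of "conjg G (inv k) v"] v vc k by simp
    then show "\<exists>u\<in>C x. v = conjg G k u" using vc k by (metis conjg_inv_conjg(2))
  qed
  then show "card (C x) = card (C y)" using bij_betw_same_card by blast
  have "y \<in> C y" using y by (auto simp: centr_def)
  then have "conjg G (inv k) y \<in> C x - Z"
    using *[of "conjg G (inv k) y"] y k by (auto simp: conjg_Z_iff)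
  then show "y \<in> cls x"
    unfolding cls_def using k y by (intro image_eqI[of _ _ "(k, conjg G (inv k) y)"]) auto
qed

end

lemma dvd_4_not_2:
  fixes m :: nat
  assumes "m dvd 4" "\<not> m dvd 2" shows "m = 4"
proof -
  have "m \<le> 4" using dvd_imp_le[OF assms(1)] by simp
  then have "m = 0 \<or> m = 1 \<or> m = 2 \<or> m = 3 \<or> m = 4" by linarith
  then show ?thesis using assms by auto
qed

context ca_group
begin

lemma card_Z_pos: "card Z > 0"
  using subgroup.one_closed[OF Z_subgroup] fin_Z by (auto simp: card_gt_0_iff)

lemma card_Z_dvd: "x \<in> carrier G \<Longrightarrow> card Z dvd card (C x)"
  by (simp add: card_subgroup_dvd Z_subgroup centr_subgroup Z_subset_C)

lemma card_Z_less: 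
  assumes "x \<in> carrier G - Z" shows "card Z < card (C x)"
proof (rule psubset_card_mono[OF fin_C])
  have "x \<in> C x" using assms by (auto simp: centr_def)
  then show "Z \<subset> C x" using Z_subset_C[of x] assms by blast
qed

lemma card_disjoint_classes:
  assumes "x \<in> carrier G - Z" "y \<in> carrier G - Z" "y \<notin> cls x"
  shows "card (cls x \<union> cls y) = card (cls x) + card (cls y)"
    and "card (cls x) + card (cls y) + card Z \<le> order G"
proof -
  have "cls x \<inter> cls y = {}" using cls_meet(1) assms by blast
  then show *: "card (cls x \<union> cls y) = card (cls x) + card (cls y)"
    by (simp add: card_Un_disjoint fin_cls)
  have "card (cls x \<union> cls y \<union> Z) = card (cls x \<union> cls y) + card Z"
    using cls_subset fin_cls fin_Z by (intro card_Un_disjoint) auto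
  moreover have "card (cls x \<union> cls y \<union> Z) \<le> order G"
    unfolding order_def using cls_subset Z_subset fin by (intro card_mono) auto
  ultimately show "card (cls x) + card (cls y) + card Z \<le> order G" using * by simp
qed

text \<open>Here \<open>card_cls\<close> gives the class the proportion 1 - 1/k of the group, where
  k is the index of \<open>Z\<close> in \<open>C x\<close>, and k is at least 2.\<close>

lemma self_normalizing_class:
  assumes x: "x \<in> carrier G - Z" and nrm: "nrm x = C x"
  shows "order G \<le> 2 * card (cls x)"
proof -
  obtain k where k: "card (C x) = card Z * k" using card_Z_dvd x by blast
  have "k \<noteq> 0" "k \<noteq> 1" using card_Z_less[OF x] k by (intro notI; simp)+
  then have "k \<ge> 2" by linarith
  then have "card (C x) \<le> 2 * (card (C x) - card Z)"
    using mult_le_mono2[of 2 k "card Z"] unfolding k by linarith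
  then have "order G * card (C x) \<le> order G * (2 * (card (C x) - card Z))" by simp
  also have "\<dots> = 2 * card (cls x) * card (C x)" using card_cls[OF x] nrm by simp
  finally show ?thesis using card_Z_less[OF x] by (metis mult_le_cancel2 less_nat_zero_code neq0_conv)
qed

text \<open>All flips act alike on x, so \<open>nrm x\<close> is the union of \<open>C x\<close> and
  one further coset. Hence twice the order of \<open>C x\<close> divides the order of G, and 8 not
  dividing the latter gives the third claim. Writing 2k for the order of \<open>C x\<close>, the
  class has proportion (k - 1)/(2k), which is at least 1/3 because k is neither 1 (then
  \<open>C x = Z\<close>) nor 2 (then 4 divides).\<close>

lemma flipped_class:
  assumes x: "x \<in> carrier G - Z" and h: "h \<in> nrm x - C x"
  shows "card Z = 2" "card (nrm x) = 2 * card (C x)" "\<not> 4 dvd card (C x)"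
    "order G \<le> 3 * card (cls x)" 
proof -
  have hc: "h \<in> carrier G" using h by (auto simp: nrm_def)
  have flip: "h \<in> carrier G - C x" "conjg G h x \<in> C x" using h by (auto simp: nrm_def)
  have hh: "h \<otimes> h \<in> Z - {\<one>}" using flip_square[OF x flip] .
  have "card {\<one>, h \<otimes> h} \<le> card Z"
    using hh subgroup.one_closed[OF Z_subgroup] fin_Z by (intro card_mono) auto
  then show Z2: "card Z = 2" using hh Z_card by (auto split: if_splits)
  have C_sub: "subgroup (C x) G" using centr_subgroup x by blast
  have eq: "nrm x = C x \<union> (\<otimes>) h ` C x"
  proof (intro equalityI subsetI)
    fix k assume k: "k \<in> nrm x"
    then have kc: "k \<in> carrier G" by (auto simp: nrm_def)
    show "k \<in> C x \<union> (\<otimes>) h ` C x"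
    proof (cases "k \<in> C x")
      case False
      then have "conjg G k x = conjg G h x"
        using flip_unique[OF x _ flip(1) _ flip(2)] k by (auto simp: nrm_def)
      then have "conjg G (inv h \<otimes> k) x = x"
        using kc hc x by (simp add: conjg_conjg[symmetric])
      then have "inv h \<otimes> k \<in> C x" using centr_iff_conjg x hc kc by auto
      moreover have "k = h \<otimes> (inv h \<otimes> k)" using hc kc by (simp add: m_assoc[symmetric])
      ultimately show ?thesis by blast
    qed auto
  next
    fix k assume "k \<in> C x \<union> (\<otimes>) h ` C x"
    then show "k \<in> nrm x"
      using C_subset_nrm[of x] x h subgroup.m_closed[OF nrm_subgroup[OF x]] by auto
  qed
  have disj: "C x \<inter> (\<otimes>) h ` C x = {}"
  proof -
    have False if u: "u \<in> C x" and hu: "h \<otimes> u \<in> C x" for u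
    proof -
      have "h \<otimes> u \<otimes> inv u \<in> C x"
        using u hu subgroup.m_closed[OF C_sub] subgroup.m_inv_closed[OF C_sub] by blast
      moreover have "h \<otimes> u \<otimes> inv u = h"
        using hc u centr_subset[of x] by (auto simp: m_assoc)
      ultimately show False using h by simp
    qed
    then show ?thesis by blast
  qed
  have "card ((\<otimes>) h ` C x) = card (C x)"
    by (intro card_image inj_onI) (meson l_cancel hc subsetD centr_subset)
  then show n2: "card (nrm x) = 2 * card (C x)"
    unfolding eq using disj by (simp add: card_Un_disjoint fin_C)
  have "2 * card (C x) dvd order G"
    using card_subgroup_dvd[OF nrm_subgroup[OF x] subgroup_self] n2
    by (auto simp: nrm_def order_def)
  then show n4: "\<not> 4 dvd card (C x)"
    using not_8_dvd dvd_trans[of "2 * 4" "2 * card (C x)" "order G"] by auto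
  obtain k where k: "card (C x) = 2 * k" using card_Z_dvd x Z2 by auto
  have "k \<ge> 3" using card_Z_less[OF x] n4 k Z2 by (cases "k = 2") auto
  then have "2 * card (C x) \<le> 3 * (card (C x) - card Z)" by (simp add: k Z2)
  then have "order G * (2 * card (C x)) \<le> order G * (3 * (card (C x) - card Z))"
    by (rule mult_le_mono2)
  also have "\<dots> = 3 * card (cls x) * (2 * card (C x))"
    using card_cls[OF x] n2 by (simp add: algebra_simps)
  finally show "order G \<le> 3 * card (cls x)" using card_Z_less[OF x] by simp
qed

lemma class_third:
  assumes "x \<in> carrier G - Z" shows "order G \<le> 3 * card (cls x)"
proof (cases "nrm x = C x")
  case True then show ?thesis using self_normalizing_class[OF assms] by simp
next
  case False
  then obtain h where "h \<in> nrm x - C x" using C_subset_nrm[of x] assms by blast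
  then show ?thesis using flipped_class(4)[OF assms] by blast
qed

text \<open>Two distinct classes would each fill half of G and leave no room for \<open>Z\<close>.
  So a single class is everything outside \<open>Z\<close>, and its size forces \<open>C x\<close>
  to be all of G.\<close>

lemma solvable_of_self_normalizing:
  assumes all: "\<And>x. x \<in> carrier G - Z \<Longrightarrow> nrm x = C x"
  shows "solvable G"
  unfolding solvable_def
proof (rule commuting_imp_solvable_seq[OF subgroup_self])
  fix u v assume u: "u \<in> carrier G" and v: "v \<in> carrier G"
  show "u \<otimes> v = v \<otimes> u"
  proof (cases "carrier G = Z")
    case True then show ?thesis using Z_central u v by simp
  next
    case False
    then obtain x where x: "x \<in> carrier G - Z" using Z_subset by blast
    have "y \<in> cls x" if y: "y \<in> carrier G - Z" for y
      using card_disjoint_classes(2)[OF x y] self_normalizing_class[OF x all[OF x]]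
        self_normalizing_class[OF y all[OF y]] card_Z_pos by linarith
    then have "cls x = carrier G - Z" using cls_subset by blast
    then have "card (cls x) = order G - card Z"
      by (simp add: card_Diff_subset fin_Z Z_subset order_def)
    then have "(order G - card Z) * card (C x) = order G * (card (C x) - card Z)"
      using card_cls[OF x] all[OF x] by simp
    moreover obtain a b where "order G = card Z + a" "card (C x) = card Z + b"
      using card_mono[OF fin Z_subset] card_Z_less[OF x]
      by (metis le_iff_add less_imp_le order_def)
    ultimately have "card (C x) = order G" using card_Z_pos by (simp add: algebra_simps)
    then have "card (C x) = card (carrier G)" by (simp add: order_def)
    then have "C x = carrier G" using card_subset_eq[OF fin centr_subset] by blast
    then show ?thesis using centr_abelian[OF x] u v by simp
  qed
qed

text \<open>G permutes the two elements x and \<open>conjg G h x\<close>. The image of this action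
  is abelian, so commutators fix both points and lie in the abelian group
  \<open>C x\<close>.\<close>

lemma solvable_of_flip:
  assumes x: "x \<in> carrier G - Z" and h: "h \<in> nrm x - C x" and G: "nrm x = carrier G"
  shows "solvable G"
  unfolding solvable_def
proof (rule commutators_imp_solvable_seq[OF subgroup_self])
  have C_sub: "subgroup (C x) G" using centr_subgroup x by blast
  show "solvable_seq G (C x)"
    using commuting_imp_solvable_seq[OF C_sub centr_abelian[OF x]] .
  have xc: "x \<in> carrier G" using x by blast
  fix u v assume u: "u \<in> carrier G" and v: "v \<in> carrier G"
  define x' where "x' = conjg G h x"
  have hc: "h \<in> carrier G - C x" using h G by blast
  have x': "x' \<in> C x" using h by (auto simp: x'_def nrm_def)
  have x'c: "x' \<in> carrier G" using x' centr_subset by blast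
  have fixed: "conjg G w x = x" "conjg G w x' = x'" if w: "w \<in> C x" for w
    using w centr_iff_conjg[of x w] centr_iff_conjg[of x' w] xc x'c centr_abelian[OF x w x']
    by (auto simp: centr_def)
  have swap: "conjg G w x = x'" "conjg G w x' = x" if w: "w \<in> carrier G - C x" for w
  proof -
    have wx: "conjg G w x \<in> C x" using w G by (auto simp: nrm_def)
    show 1: "conjg G w x = x'"
      unfolding x'_def using flip_unique[OF x w hc wx] x' by (simp add: x'_def)
    \<comment> \<open>The square of a flip lies in \<open>Z\<close>, so a second application of w
      leads back to x.\<close>
    have "w \<otimes> w \<in> C x" using flip_square[OF x w wx] Z_subset_C[OF xc] by blast
    then have "conjg G (w \<otimes> w) x = x" by (rule fixed)
    then show "conjg G w x' = x" using 1 w xc by (auto simp: conjg_conjg[symmetric])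
  qed
  have comm: "conjg G (u \<otimes> v) x = conjg G (v \<otimes> u) x"
    using u v xc fixed[of u] fixed[of v] swap[of u] swap[of v]
    by (cases "u \<in> C x"; cases "v \<in> C x") (auto simp: conjg_conjg[symmetric])
  \<comment> \<open>The commutator fixes \<open>?w\<close> rather than visibly x, since it turns vu
    into uv; as \<open>?w\<close> lies in \<open>C x - Z\<close>, its centralizer is
    \<open>C x\<close> anyway.\<close>
  let ?c = "u \<otimes> v \<otimes> inv u \<otimes> inv v" and ?w = "conjg G (v \<otimes> u) x"
  have c: "?c = (u \<otimes> v) \<otimes> inv (v \<otimes> u)" using u v by (simp add: inv_mult_group m_assoc)
  have "conjg G ?c ?w = ?w"
  proof -
    have "conjg G ?c ?w = conjg G (u \<otimes> v) (conjg G (inv (v \<otimes> u)) ?w)"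
      unfolding c by (rule conjg_conjg[symmetric]) (use u v xc in simp_all)
    also have "\<dots> = conjg G (u \<otimes> v) x" using u v xc by simp
    finally show ?thesis using comm by simp
  qed
  moreover have wc: "?w \<in> carrier G" using u v xc by simp
  ultimately have "?c \<in> C ?w" using centr_iff_conjg u v by auto
  moreover have "?w \<in> C x - Z"
    using u v x G subgroup.m_closed[OF subgroup_self] by (auto simp: conjg_Z_iff nrm_def)
  ultimately show "?c \<in> C x" using C_eq[OF x] by blast
qed

text \<open>
  If h flips x, then 4 divides the order of \<open>C h\<close>, so \<open>C h\<close> is self-normalizing and the class of h
  fills at least half of G. The class of x and any further class fill at least a third each, so
  the classes of x and h exhaust G outside Z, and counting forces \<open>nrm x\<close> to be all of G.
\<close>

theorem solvable: "solvable G"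
proof (cases "\<forall>x \<in> carrier G - Z. nrm x = C x")
  case True
  then show ?thesis using solvable_of_self_normalizing by blast
next
  case False
  then obtain x h where x: "x \<in> carrier G - Z" and h: "h \<in> nrm x - C x"
    using C_subset_nrm by blast
  note fx = flipped_class[OF x h]
  have hc: "h \<in> carrier G" and hx: "h \<in> carrier G - C x" "conjg G h x \<in> C x"
    using h by (auto simp: nrm_def)
  have hZ: "h \<in> carrier G - Z" using hx Z_subset_C[of x] x by blast
  have hh: "h \<otimes> h \<in> Z - {\<one>}" using flip_square[OF x hx] .
  have hCh: "h \<in> C h" using hc by (auto simp: centr_def)
  \<comment> \<open>The square of h is the generator z of the two-element group \<open>Z\<close>, so
    h has order 4 and lies in its own centralizer.\<close>
  have "4 dvd card (C h)"
  proof -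
    obtain z where z: "Z = {\<one>, z}" "z \<noteq> \<one>"
      using fx(1) subgroup.one_closed[OF Z_subgroup]
      by (metis card_2_iff insert_commute insertE singletonD)
    interpret CG: group "G\<lparr>carrier := C h\<rparr>"
      using subgroup_imp_group[OF centr_subgroup[OF hc]] .
    have zc: "z \<in> carrier G" "h \<otimes> h = z" using z Z_subset hh by auto
    have zz: "z \<otimes> z = \<one>"
    proof (rule ccontr)
      assume "z \<otimes> z \<noteq> \<one>"
      then have "z \<otimes> z = z" using z subgroup.m_closed[OF Z_subgroup, of z z] by auto
      then show False using z zc by (simp add: r_cancel_one)
    qed
    have "h [^]\<^bsub>G\<lparr>carrier := C h\<rparr>\<^esub> (4::nat) = \<one>"
      using zz zc hc by (simp add: numeral_eq_Suc m_assoc)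
    moreover have "h [^]\<^bsub>G\<lparr>carrier := C h\<rparr>\<^esub> (2::nat) \<noteq> \<one>"
      using z zc hc by (simp add: numeral_eq_Suc)
    ultimately have "CG.ord h dvd 4" "\<not> CG.ord h dvd 2"
      using CG.pow_eq_id[of h] hCh by auto
    then have "CG.ord h = 4" by (rule dvd_4_not_2)
    moreover have "CG.ord h dvd order (G\<lparr>carrier := C h\<rparr>)"
      using CG.ord_dvd_group_order hCh by simp
    ultimately show ?thesis by (simp add: order_def)
  qed
  then have nh: "nrm h = C h"
    using flipped_class(3)[OF hZ] C_subset_nrm[OF hc] by blast
  have xh: "h \<notin> cls x"
  proof
    assume "h \<in> cls x"
    then have "cls x \<inter> cls h \<noteq> {}" using mem_cls[OF hZ] by blast
    then show False using cls_meet(2)[OF x hZ] \<open>4 dvd card (C h)\<close> fx(3) by simp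
  qed
  have "y \<in> cls x \<union> cls h" if y: "y \<in> carrier G - Z" for y
  proof (rule ccontr)
    assume ny: "y \<notin> cls x \<union> cls h"
    have "(cls x \<union> cls h) \<inter> cls y = {}" using cls_meet(1)[OF x y] cls_meet(1)[OF hZ y] ny by blast
    then have "card (cls x \<union> cls h \<union> cls y) = card (cls x) + card (cls h) + card (cls y)"
      using card_disjoint_classes(1)[OF x hZ xh] by (simp add: card_Un_disjoint fin_cls)
    moreover have "card (cls x \<union> cls h \<union> cls y) \<le> card (carrier G)"
      using cls_subset fin by (intro card_mono) auto
    ultimately show False
      using fx(4) self_normalizing_class[OF hZ nh] class_third[OF y]
        order_gt_0_iff_finite fin by (simp add: order_def)
  qed
  then have cover: "cls x \<union> cls h = carrier G - Z" using cls_subset by blast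
  have "card (carrier G - Z) + 2 = order G"
    using card_Diff_subset[OF fin_Z Z_subset] card_mono[OF fin Z_subset] fx(1) by (simp add: order_def)
  then have sum: "card (cls x) + card (cls h) + 2 = order G"
    using card_disjoint_classes(1)[OF x hZ xh] cover by simp
  obtain b where b: "card (C h) = 4 * b" using \<open>4 dvd card (C h)\<close> by blast
  define n where "n = card (cls h)"
  have b1: "b \<ge> 1" using b card_Z_less[OF hZ] by (cases b) auto
  have "n * (4 * b) = order G * (4 * b - 2)" using card_cls[OF hZ] nh b fx(1) by (simp add: n_def)
  also have "\<dots> + 2 * order G = order G * (4 * b)"
    using b1 by (cases b) (simp_all add: algebra_simps)
  finally have ch: "2 * (n * b) + order G = 2 * (order G * b)" by (simp add: algebra_simps)
  \<comment> \<open>The class of h has proportion 1 - 1/(2b). For b at least 2 this is at least 3/4,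
    too much beside the third taken by the class of x.\<close>
  have "b = 1"
  proof (rule ccontr)
    assume "b \<noteq> 1"
    then have b2: "order G * 2 \<le> order G * b" using b1 by (intro mult_le_mono2) auto
    have "4 * n < order G * 3"
      using fx(4) sum by (simp add: n_def)
    then have "(4 * n) * b < (order G * 3) * b" using b1 by (intro mult_strict_right_mono) auto
    then have "4 * (n * b) < 3 * (order G * b)" by (simp add: algebra_simps)
    then show False using ch b2 by linarith
  qed
  then have "4 * card (cls h) = 2 * order G" using ch by (simp add: n_def)
  then have s: "2 * card (cls x) + 4 = order G" using sum by linarith
  \<comment> \<open>The class of h is now exactly half of G, which leaves |G|/2 - 2 elements for the
    class of x. Comparing with \<open>card_cls\<close> yields |G| = 2(c + 2), the order of
    \<open>nrm x\<close>.\<close>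
  define c where "c = card (C x) - 2"
  then have c: "card (C x) = c + 2" using card_Z_less[OF x] fx(1) by simp
  have "card (cls x) * (2 * (c + 2)) = order G * c" using card_cls[OF x] fx c by simp
  then have "order G * c + 4 * (c + 2) = (2 * card (cls x) + 4) * (c + 2)" by (simp add: algebra_simps)
  also have "\<dots> = order G * (c + 2)" using s by simp
  finally have "4 * (c + 2) = order G * 2" by (simp add: algebra_simps)
  then have "card (nrm x) = card (carrier G)" using fx(2) c by (simp add: order_def)
  then have "nrm x = carrier G" using card_subset_eq[OF fin] by (auto simp: nrm_def)
  then show ?thesis using solvable_of_flip[OF x h] by blast
qed

end

section \<open>Two-by-two matrices modulo a prime\<close>

text \<open>Two vectors parallel to the same nonzero vector (b, c, m) modulo p are parallel. By
  \<open>mmul_commute_iff\<close>, applied to off-diagonal entries and diagonal difference, this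
  says that centralizers of nonscalar matrices are abelian. Each cross product is killed by b, c and
  m, one of which is a unit.\<close>

lemma cross_products_vanish:
  fixes p :: int
  assumes p: "Factorial_Ring.prime p" and nz: "\<not> (p dvd b \<and> p dvd c \<and> p dvd m)"
    and u: "p dvd b * g - c * f" "p dvd b * r - m * f" "p dvd c * r - m * g"
    and v: "p dvd b * k - c * j" "p dvd b * z - m * j" "p dvd c * z - m * k"
  shows "p dvd f * k - g * j" "p dvd f * z - r * j" "p dvd g * z - r * k"
proof -
  have "p dvd b * (f * k - g * j)" "p dvd b * (f * z - r * j)"
    "p dvd c * (f * k - g * j)" "p dvd c * (g * z - r * k)"
    "p dvd m * (f * z - r * j)" "p dvd m * (g * z - r * k)"
    using u v by Groebner_Basis.algebra+
  moreover have "p dvd b * (g * z - r * k)" using u v by Groebner_Basis.algebra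
  moreover have "p dvd c * (f * z - r * j)" using u v by Groebner_Basis.algebra
  moreover have "p dvd m * (f * k - g * j)" using u v by Groebner_Basis.algebra
  ultimately show "p dvd f * k - g * j" "p dvd f * z - r * j" "p dvd g * z - r * k"
    using nz prime_dvd_mult_iff[OF p] by blast+
qed

text \<open>Opposite signs for b and c would give 2bc = 0 modulo p; then b = -b or c = -c, and the
  signs can be made to agree. Not cancelling the 2 keeps p = 2 included.\<close>

lemma sign_choice:
  fixes p :: int
  assumes p: "Factorial_Ring.prime p"
    and "p dvd B * B - b * b" "p dvd C * C - c * c" "p dvd B * C - b * c"
  shows "p dvd B - b \<and> p dvd C - c \<or> p dvd B + b \<and> p dvd C + c"
proof -
  note pm = prime_dvd_mult_iff[OF p]
  have "p dvd (B - b) * (B + b)" "p dvd (C - c) * (C + c)"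
    using assms by (simp_all add: algebra_simps)
  then have 1: "p dvd B - b \<or> p dvd B + b" "p dvd C - c \<or> p dvd C + c" by (simp_all add: pm)
  have 2: ?thesis if x: "p dvd B - b" "p dvd C + c"
  proof -
    have "p dvd b * (2 * c)" using x assms(4) by Groebner_Basis.algebra
    then consider "p dvd b" | "p dvd 2 * c" using pm by blast
    then show ?thesis
    proof cases
      case 1
      then have "p dvd B + b" using x by Groebner_Basis.algebra
      then show ?thesis using x by blast
    next
      case 2
      then have "p dvd C - c" using x by Groebner_Basis.algebra
      then show ?thesis using x by blast
    qed
  qed
  have 3: ?thesis if x: "p dvd B + b" "p dvd C - c"
  proof -
    have "p dvd c * (2 * b)" using x assms(4) by Groebner_Basis.algebra
    then consider "p dvd c" | "p dvd 2 * b" using pm by blast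
    then show ?thesis
    proof cases
      case 1
      then have "p dvd C + c" using x by Groebner_Basis.algebra
      then show ?thesis using x by blast
    next
      case 2
      then have "p dvd B - b" using x by Groebner_Basis.algebra
      then show ?thesis using x by blast
    qed
  qed
  show ?thesis using 1 2 3 by blast
qed

text \<open>
  For h x = y h with y commuting with x, the off-diagonal entries and diagonal differences of x and y
  are proportional, and equality of the discriminants makes the factor 1 or -1. The statement is
  arranged so that it also covers p = 2.
\<close>

lemma conjugate_in_centralizer:
  fixes p :: int
  assumes p: "Factorial_Ring.prime p"
    and det_x: "p dvd a * d - b * c - 1" and det_h: "p dvd e * k - f * g - 1"
    and conj: "p dvd e * a + f * c - A * e - B * g" "p dvd e * b + f * d - A * f - B * k"
      "p dvd g * a + k * c - C * e - D * g" "p dvd g * b + k * d - C * f - D * k"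
    and comm: "p dvd b * C - c * B" "p dvd b * (A - D) - (a - d) * B" "p dvd c * (A - D) - (a - d) * C"
    and nonscalar: "\<not> (p dvd b \<and> p dvd c \<and> p dvd a - d)"
    and regular: "\<not> p dvd (a + d) * (a + d) - 4"
    and neq: "\<not> (p dvd A - a \<and> p dvd B - b \<and> p dvd C - c \<and> p dvd D - d)"
  shows "p dvd A - d" "p dvd B + b" "p dvd C + c" "p dvd D - a" "p dvd e + k"
proof -
  note pm = prime_dvd_mult_iff[OF p]
  define m where "m = a - d"
  define M where "M = A - D"
  define \<Delta> where "\<Delta> = m * m + 4 * b * c"
  have tr: "p dvd A + D - a - d" using det_h conj by Groebner_Basis.algebra
  have det: "p dvd A * D - B * C - 1"
  proof -
    have "p dvd (e * k - f * g) * (A * D - B * C) - (e * k - f * g) * (a * d - b * c)"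
      using conj by Groebner_Basis.algebra
    then show ?thesis using det_h det_x by Groebner_Basis.algebra
  qed
  \<comment> \<open>\<open>\<Delta>\<close> is the discriminant of the characteristic polynomial, (a
    + d)^2 - 4 for determinant 1.\<close>
  have D: "\<not> p dvd \<Delta>"
  proof
    assume "p dvd \<Delta>"
    then have "p dvd (a + d) * (a + d) - 4" using det_x unfolding \<Delta>_def m_def by Groebner_Basis.algebra
    then show False using regular by blast
  qed
  have D': "p dvd M * M + 4 * B * C - \<Delta>" using tr det det_x unfolding \<Delta>_def M_def m_def
    by Groebner_Basis.algebra
  have co: "p dvd b * C - c * B" "p dvd b * M - m * B" "p dvd c * M - m * C"
    using comm by (simp_all add: M_def m_def)
  \<comment> \<open>If (B, C, M) is t times (b, c, m), equal discriminants force t^2 = 1.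
    Multiplying by \<open>\<Delta>\<close> expresses this without introducing t: products of two
    entries agree for both matrices.\<close>
  have "p dvd \<Delta> * (B * B - b * b)" "p dvd \<Delta> * (C * C - c * c)" "p dvd \<Delta> * (B * C - b * c)"
    "p dvd \<Delta> * (B * M - b * m)" "p dvd \<Delta> * (C * M - c * m)"
    using co D' unfolding \<Delta>_def by Groebner_Basis.algebra+
  then have sq: "p dvd B * B - b * b" "p dvd C * C - c * c" "p dvd B * C - b * c"
    "p dvd B * M - b * m" "p dvd C * M - c * m" using D pm by blast+
  \<comment> \<open>A and D have the same sum and product as a and d, so A is a root of the
    polynomial with roots a and d.\<close>
  have "p dvd (A - a) * (A - d)" using tr det det_x sq(3) by Groebner_Basis.algebra
  then have cases: "p dvd A - a \<or> p dvd A - d" using pm by blast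
  \<comment> \<open>With sign 1 the conjugate would be x itself, which \<open>neq\<close> excludes.
    With sign -1 it is the adjugate, that is, the inverse of x: a flip inverts x.\<close>
  have main: "p dvd A - d \<and> p dvd B + b \<and> p dvd C + c"
  proof (cases "p dvd m")
    case m: True
    have "p dvd A - a \<and> p dvd D - d \<and> p dvd A - d"
      using cases
    proof
      assume x: "p dvd A - a"
      have "p dvd D - d" "p dvd A - d" using x tr m unfolding m_def by Groebner_Basis.algebra+
      then show ?thesis using x by blast
    next
      assume x: "p dvd A - d"
      have "p dvd A - a" "p dvd D - d" using x tr m unfolding m_def by Groebner_Basis.algebra+
      then show ?thesis using x by blast
    qed
    then show ?thesis using sign_choice[OF p sq(1,2,3)] neq by blast
  next
    case m: False
    have n: "\<not> p dvd A - a"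
    proof
      assume x: "p dvd A - a"
      then have y: "p dvd D - d" using tr by Groebner_Basis.algebra
      have "p dvd m * (B - b)" "p dvd m * (C - c)"
        using x y sq(4,5) unfolding M_def m_def by Groebner_Basis.algebra+
      then show False using neq x y m pm by blast
    qed
    then have x: "p dvd A - d" using cases by blast
    then have y: "p dvd D - a" using tr by Groebner_Basis.algebra
    have "p dvd m * (B + b)" "p dvd m * (C + c)"
      using x y sq(4,5) unfolding M_def m_def by Groebner_Basis.algebra+
    then show ?thesis using x m pm by blast
  qed
  then show "p dvd A - d" "p dvd B + b" "p dvd C + c" by auto
  show Da: "p dvd D - a" using main tr by Groebner_Basis.algebra
  \<comment> \<open>With the conjugate known, the entries of hx = yh show that the trace of h kills
    the vector (b, c, a - d). Trace 0 and determinant 1 will give that h squares to -1.\<close>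
  have "p dvd b * (e + k)" "p dvd c * (e + k)" "p dvd (a - d) * (e + k)"
    using main Da conj by Groebner_Basis.algebra+
  then show "p dvd e + k" using nonscalar pm by blast
qed

section \<open>The group GL(2,p)\<close>

text \<open>Matrices are stored row by row, with entries reduced to {0..<p}.\<close>

type_synonym mat2 = "int \<times> int \<times> int \<times> int"

fun mdet :: "mat2 \<Rightarrow> int" where
  "mdet (a, b, c, d) = a * d - b * c"

fun mmul :: "int \<Rightarrow> mat2 \<Rightarrow> mat2 \<Rightarrow> mat2" where
  "mmul p (a, b, c, d) (e, f, g, h) =
    ((a * e + b * g) mod p, (a * f + b * h) mod p, (c * e + d * g) mod p, (c * f + d * h) mod p)"

definition mats :: "int \<Rightarrow> mat2 set" where
  "mats p = {0..<p} \<times> {0..<p} \<times> {0..<p} \<times> {0..<p}"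

definition GL2 :: "int \<Rightarrow> mat2 monoid" where
  "GL2 p = \<lparr>carrier = {x \<in> mats p. \<not> p dvd mdet x}, monoid.mult = mmul p, one = (1, 0, 0, 1)\<rparr>"

lemma GL2_simps [simp]:
  "monoid.mult (GL2 p) = mmul p" "one (GL2 p) = (1, 0, 0, 1)"
  "x \<in> carrier (GL2 p) \<longleftrightarrow> x \<in> mats p \<and> \<not> p dvd mdet x"
  by (auto simp: GL2_def)

lemma mats_eq_iff:
  assumes "(a, b, c, d) \<in> mats p" "(e, f, g, h) \<in> mats p"
  shows "(a, b, c, d) = (e, f, g, h) \<longleftrightarrow> p dvd a - e \<and> p dvd b - f \<and> p dvd c - g \<and> p dvd d - h"
proof -
  have *: "u = v \<longleftrightarrow> p dvd u - v" if "u \<in> {0..<p}" "v \<in> {0..<p}" for u v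
    using that by (metis atLeastLessThan_iff mod_eq_dvd_iff mod_pos_pos_trivial)
  show ?thesis
    using assms *[of a e] *[of b f] *[of c g] *[of d h] by (simp add: mats_def)
qed

lemma mod_dot:
  fixes p :: int
  shows "(x mod p * a + y mod p * b) mod p = (x * a + y * b) mod p"
    "(a * (x mod p) + b * (y mod p)) mod p = (a * x + b * y) mod p"
    "(x mod p * (y mod p) - z mod p * (w mod p)) mod p = (x * y - z * w) mod p"
  by (metis mod_add_eq mod_mult_left_eq, metis mod_add_eq mod_mult_right_eq,
      metis mod_diff_eq mod_mult_eq)

lemma mmul_assoc: "mmul p (mmul p x y) z = mmul p x (mmul p y z)"
  by (cases x; cases y; cases z) (simp add: mod_dot, simp add: algebra_simps)

lemma mdet_mmul: "mdet (mmul p x y) mod p = (mdet x * mdet y) mod p"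
  by (cases x; cases y) (simp add: mod_dot, simp add: algebra_simps)

lemma mmul_in_mats: "p > 0 \<Longrightarrow> mmul p x y \<in> mats p"
  by (cases x; cases y) (simp add: mats_def)

lemma mmul_eq_iff:
  "mmul p (a, b, c, d) (e, f, g, h) = mmul p (a', b', c', d') (e', f', g', h') \<longleftrightarrow>
    p dvd (a * e + b * g) - (a' * e' + b' * g') \<and> p dvd (a * f + b * h) - (a' * f' + b' * h') \<and>
    p dvd (c * e + d * g) - (c' * e' + d' * g') \<and> p dvd (c * f + d * h) - (c' * f' + d' * h')"
  by (simp add: mod_eq_dvd_iff)

lemma finite_mats: "finite (mats p)"
  by (simp add: mats_def)

lemma mdet_mmul_dvd: "p dvd mdet (mmul p x y) \<longleftrightarrow> p dvd mdet x * mdet y"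
  by (simp only: dvd_eq_mod_eq_0 mdet_mmul)

lemma group_GL2:
  assumes p: "Factorial_Ring.prime p"
  shows "group (GL2 p)"
proof (rule groupI)
  have p1: "p > 1" using p prime_gt_1_int by blast
  show "x \<otimes>\<^bsub>GL2 p\<^esub> y \<in> carrier (GL2 p)" if "x \<in> carrier (GL2 p)" "y \<in> carrier (GL2 p)" for x y
    using that p1 prime_dvd_mult_iff[OF p] by (simp add: mmul_in_mats mdet_mmul_dvd)
  show "\<one>\<^bsub>GL2 p\<^esub> \<in> carrier (GL2 p)" using p1 by (auto simp: mats_def dest: zdvd_imp_le)
  show "\<one>\<^bsub>GL2 p\<^esub> \<otimes>\<^bsub>GL2 p\<^esub> x = x" if "x \<in> carrier (GL2 p)" for x
    using that by (cases x) (auto simp: mats_def)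
  show "x \<otimes>\<^bsub>GL2 p\<^esub> y \<otimes>\<^bsub>GL2 p\<^esub> z = x \<otimes>\<^bsub>GL2 p\<^esub> (y \<otimes>\<^bsub>GL2 p\<^esub> z)" for x y z
    by (simp add: mmul_assoc)
  show "\<exists>y\<in>carrier (GL2 p). y \<otimes>\<^bsub>GL2 p\<^esub> x = \<one>\<^bsub>GL2 p\<^esub>" if x: "x \<in> carrier (GL2 p)" for x
  proof -
    obtain a b c d where abcd: "x = (a, b, c, d)" by (cases x)
    have "coprime p (a * d - b * c)" using x p abcd by (simp add: prime_imp_coprime)
    then obtain q r where "q * (a * d - b * c) + r * p = 1"
      using bezout_int[of "a * d - b * c" p] by (auto simp: coprime_commute coprime_iff_gcd_eq_1)
    then have q: "p dvd q * (a * d - b * c) - 1" by Groebner_Basis.algebra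
    \<comment> \<open>The adjugate of x, scaled by the inverse q of its determinant modulo
      p.\<close>
    define y where "y = ((q * d) mod p, (- q * b) mod p, (- q * c) mod p, (q * a) mod p)"
    have "mmul p y x = mmul p (q * d, - q * b, - q * c, q * a) x"
      unfolding y_def abcd by (simp add: mod_dot(1))
    also have "\<dots> = mmul p (1, 0, 0, 1) (1, 0, 0, 1)"
      unfolding abcd mmul_eq_iff using q by (simp add: algebra_simps)
    also have "\<dots> = (1, 0, 0, 1)" using p1 by simp
    finally have yx: "mmul p y x = (1, 0, 0, 1)" .
    have "\<not> p dvd mdet y"
    proof
      assume "p dvd mdet y"
      then have "p dvd mdet (mmul p y x)" by (simp add: mdet_mmul_dvd)
      then show False using yx p1 by (auto dest: zdvd_imp_le)
    qed
    then show ?thesis using yx p1 by (intro bexI[of _ y]) (simp_all add: y_def mats_def)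
  qed
qed

text \<open>Scalar parts cancel in xy - yx. What remains is the cross product of the vectors (b, c,
  a - d) and (f, g, e - h).\<close>

lemma mmul_commute_iff:
  "mmul p (a, b, c, d) (e, f, g, h) = mmul p (e, f, g, h) (a, b, c, d) \<longleftrightarrow>
    p dvd b * g - c * f \<and> p dvd b * (e - h) - (a - d) * f \<and> p dvd c * (e - h) - (a - d) * g"
  (is "?L \<longleftrightarrow> ?R")
proof
  assume ?L
  then have *: "p dvd (a * e + b * g) - (e * a + f * c)" "p dvd (a * f + b * h) - (e * b + f * d)"
      "p dvd (c * e + d * g) - (g * a + h * c)" "p dvd (c * f + d * h) - (g * b + h * d)"
    unfolding mmul_eq_iff by blast+
  have "p dvd b * g - c * f" "p dvd b * (e - h) - (a - d) * f" "p dvd c * (e - h) - (a - d) * g"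
    using * by Groebner_Basis.algebra+
  then show ?R by blast
next
  assume ?R
  then have *: "p dvd b * g - c * f" "p dvd b * (e - h) - (a - d) * f" "p dvd c * (e - h) - (a - d) * g"
    by blast+
  have "p dvd (a * e + b * g) - (e * a + f * c)" "p dvd (a * f + b * h) - (e * b + f * d)"
      "p dvd (c * e + d * g) - (g * a + h * c)" "p dvd (c * f + d * h) - (g * b + h * d)"
    using * by Groebner_Basis.algebra+
  then show ?L unfolding mmul_eq_iff by blast
qed

text \<open>
  The hypotheses say that x - s is nilpotent, so the n-th power of x is
  \<open>s ^ n + n * s ^ (n - 1) * (x - s)\<close>; both sides are multiplied by s to avoid the exponent n - 1.
\<close>

lemma pow_entries:
  fixes p s :: int
  assumes det: "p dvd a * d - b * c - 1" and s: "p dvd 2 * s - (a + d)" "p dvd s * s - 1"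
    and pow: "(a, b, c, d) [^]\<^bsub>GL2 p\<^esub> (n::nat) = (\<alpha>, \<beta>, \<gamma>, \<delta>)"
  shows "p dvd s * \<alpha> - s ^ n * (s + int n * (a - s)) \<and> p dvd s * \<beta> - s ^ n * int n * b \<and>
    p dvd s * \<gamma> - s ^ n * int n * c \<and> p dvd s * \<delta> - s ^ n * (s + int n * (d - s))"
  using pow
proof (induction n arbitrary: \<alpha> \<beta> \<gamma> \<delta>)
  case 0
  then show ?case by simp
next
  case (Suc n)
  obtain \<alpha>' \<beta>' \<gamma>' \<delta>' where e: "(a, b, c, d) [^]\<^bsub>GL2 p\<^esub> n = (\<alpha>', \<beta>', \<gamma>', \<delta>')"
    by (cases "(a, b, c, d) [^]\<^bsub>GL2 p\<^esub> n")
  define u where "u = s ^ n"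
  define m where "m = int n"
  have m1: "int (Suc n) = m + 1" "s ^ Suc n = s * u" by (simp_all add: m_def u_def)
  have ih: "p dvd s * \<alpha>' - u * (s + m * (a - s))" "p dvd s * \<beta>' - u * m * b"
    "p dvd s * \<gamma>' - u * m * c" "p dvd s * \<delta>' - u * (s + m * (d - s))"
    using Suc.IH[OF e] by (simp_all add: u_def m_def)
  have "mmul p (\<alpha>', \<beta>', \<gamma>', \<delta>') (a, b, c, d) = (\<alpha>, \<beta>, \<gamma>, \<delta>)"
    using Suc.prems e by simp
  then have st: "p dvd \<alpha>' * a + \<beta>' * c - \<alpha>" "p dvd \<alpha>' * b + \<beta>' * d - \<beta>"
    "p dvd \<gamma>' * a + \<delta>' * c - \<gamma>" "p dvd \<gamma>' * b + \<delta>' * d - \<delta>"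
    by (auto simp: minus_mod_eq_mult_div)
  \<comment> \<open>The matrix x - s has trace and determinant 0, so its square vanishes by
    Cayley-Hamilton; these are the entrywise facts needed.\<close>
  have nil: "p dvd (a - s) * (a - s) + b * c" "p dvd (d - s) * (d - s) + b * c" "p dvd (a - s) + (d - s)"
    using det s by Groebner_Basis.algebra+
  have "p dvd s * \<alpha> - s * u * (s + (m + 1) * (a - s))"
  proof -
    have "s * \<alpha> - s * u * (s + (m + 1) * (a - s)) = - s * (\<alpha>' * a + \<beta>' * c - \<alpha>) + a * (s * \<alpha>' - u * (s + m * (a - s))) + c * (s * \<beta>' - u * m * b) + u * m * ((a - s) * (a - s) + b * c)"
      by (simp add: algebra_simps)
    then show ?thesis using ih st nil by (simp only: dvd_add dvd_mult)
  qed
  moreover have "p dvd s * \<beta> - s * u * (m + 1) * b"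
  proof -
    have "s * \<beta> - s * u * (m + 1) * b = - s * (\<alpha>' * b + \<beta>' * d - \<beta>) + b * (s * \<alpha>' - u * (s + m * (a - s))) + d * (s * \<beta>' - u * m * b) + u * m * b * ((a - s) + (d - s))"
      by (simp add: algebra_simps)
    then show ?thesis using ih st nil by (simp only: dvd_add dvd_mult)
  qed
  moreover have "p dvd s * \<gamma> - s * u * (m + 1) * c"
  proof -
    have "s * \<gamma> - s * u * (m + 1) * c = - s * (\<gamma>' * a + \<delta>' * c - \<gamma>) + a * (s * \<gamma>' - u * m * c) + c * (s * \<delta>' - u * (s + m * (d - s))) + u * m * c * ((a - s) + (d - s))"
      by (simp add: algebra_simps)
    then show ?thesis using ih st nil by (simp only: dvd_add dvd_mult)
  qed
  moreover have "p dvd s * \<delta> - s * u * (s + (m + 1) * (d - s))"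
  proof -
    have "s * \<delta> - s * u * (s + (m + 1) * (d - s)) = - s * (\<gamma>' * b + \<delta>' * d - \<delta>) + b * (s * \<gamma>' - u * m * c) + d * (s * \<delta>' - u * (s + m * (d - s))) + u * m * ((d - s) * (d - s) + b * c)"
      by (simp add: algebra_simps)
    then show ?thesis using ih st nil by (simp only: dvd_add dvd_mult)
  qed
  ultimately show ?case unfolding m1 by blast
qed

text \<open>The characteristic polynomial has a double root s = 1 or s = -1. Up to a unit, the
  off-diagonal entries and the diagonal difference of the n-th power are n times those of x. Since x
  is not scalar, the power can be the identity only if p divides n.\<close>

lemma parabolic_order:
  fixes p :: int
  assumes p: "Factorial_Ring.prime p" and det: "p dvd a * d - b * c - 1"
    and nonscalar: "\<not> (p dvd b \<and> p dvd c \<and> p dvd a - d)"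
    and disc: "p dvd (a + d) * (a + d) - 4"
    and pow: "(a, b, c, d) [^]\<^bsub>GL2 p\<^esub> (n::nat) = \<one>\<^bsub>GL2 p\<^esub>"
  shows "p dvd int n"
proof -
  note pm = prime_dvd_mult_iff[OF p]
  have "p dvd (a + d - 2) * (a + d + 2)" using disc by (simp add: algebra_simps)
  then have "p dvd a + d - 2 \<or> p dvd a + d + 2" using pm by blast
  then obtain s where s: "s = 1 \<or> s = -1" "p dvd 2 * s - (a + d)"
  proof
    assume "p dvd a + d - 2"
    then have "p dvd 2 * 1 - (a + d)" using dvd_minus_iff[of p "a + d - 2"] by simp
    then show ?thesis using that by blast
  next
    assume "p dvd a + d + 2"
    then have "p dvd 2 * (-1) - (a + d)" 
    proof -
      have "2 * (-1) - (a + d) = - (a + d + 2)" by simp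
      then show ?thesis using \<open>p dvd a + d + 2\<close> by (simp only: dvd_minus_iff)
    qed
    then show ?thesis using that by blast
  qed
  have ss: "s * s = 1" using s(1) by auto
  have "s ^ n = 1 \<or> s ^ n = -1" using s(1) by (cases "even n") auto
  then have nu: "\<not> p dvd s ^ n" using p by (auto simp: not_prime_unit)
  have e: "p dvd s * 1 - s ^ n * (s + int n * (a - s))" "p dvd s * 0 - s ^ n * int n * b"
    "p dvd s * 0 - s ^ n * int n * c" "p dvd s * 1 - s ^ n * (s + int n * (d - s))"
    using pow_entries[OF det s(2), of n 1 0 0 1] ss pow by auto
  have "p dvd s ^ n * (int n * b)" "p dvd s ^ n * (int n * c)"
    using e(2,3) by (simp_all add: mult.assoc)
  moreover have "p dvd s ^ n * (int n * (a - d))"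
    using dvd_diff[OF e(4,1)] by (simp add: algebra_simps)
  ultimately show ?thesis using nu nonscalar pm by blast
qed

section \<open>Solvable subgroups of SL(2,p) and GL(2,p)\<close>

text \<open>Verifies the assumptions of \<open>ca_group\<close> for the scalar matrices
  \<open>Z\<close> in \<open>S\<close>, including the case p = 2.\<close>

lemma SL2_subgroup_solvable:
  assumes p: "Factorial_Ring.prime p" and S: "subgroup S (GL2 p)"
    and det: "\<And>x. x \<in> S \<Longrightarrow> p dvd mdet x - 1"
    and coprime: "\<not> p dvd int (card S)" and n8: "\<not> 8 dvd card S"
  shows "solvable_seq (GL2 p) S"
proof -
  interpret GL: group "GL2 p" using group_GL2[OF p] .
  let ?S = "GL2 p\<lparr>carrier := S\<rparr>"
  interpret S: group ?S using GL.subgroup_imp_group[OF S] .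
  note pm = prime_dvd_mult_iff[OF p]
  have p1: "p > 1" using p prime_gt_1_int by blast
  have S_mats: "x \<in> mats p" if "x \<in> S" for x
    using subgroup.mem_carrier[OF S that] by simp
  then have finS: "finite S" using finite_mats[of p] by (meson finite_subset subsetI)
  define Z where "Z = {x \<in> S. \<exists>a. x = (a, 0, 0, a)}"
  have S_det: "p dvd a * d - b * c - 1" if "(a, b, c, d) \<in> S" for a b c d
    using det[OF that] by simp
  have nonscalar: "\<not> (p dvd b \<and> p dvd c \<and> p dvd a - d)" if "(a, b, c, d) \<in> S - Z" for a b c d
  proof
    assume *: "p dvd b \<and> p dvd c \<and> p dvd a - d"
    have "(a, b, c, d) \<in> mats p" "(a, 0, 0, a) \<in> mats p"
      using that S_mats[of "(a, b, c, d)"] p1 by (auto simp: mats_def)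
    then have "(a, b, c, d) = (a, 0, 0, a)"
      using * mats_eq_iff[of a b c d p a 0 0 a] by (simp add: dvd_diff_commute)
    then show False using that unfolding Z_def by blast
  qed
  \<comment> \<open>A nonscalar element with zero discriminant has order divisible by p, against x
    to the power |S| being 1.\<close>
  have regular: "\<not> p dvd (a + d) * (a + d) - 4" if x: "(a, b, c, d) \<in> S - Z" for a b c d
  proof
    assume *: "p dvd (a + d) * (a + d) - 4"
    have "(a, b, c, d) [^]\<^bsub>?S\<^esub> order ?S = \<one>\<^bsub>?S\<^esub>"
      using S.pow_order_eq_1 x finS by simp
    then have "(a, b, c, d) [^]\<^bsub>GL2 p\<^esub> card S = \<one>\<^bsub>GL2 p\<^esub>"
      using x by (simp add: order_def GL.nat_pow_consistent[symmetric])
    then show False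
      using parabolic_order[OF p S_det nonscalar[OF x] *] x coprime by blast
  qed
  have comm: "y \<in> centr ?S x \<longleftrightarrow> y \<in> S \<and> mmul p x y = mmul p y x" for x y
    by (auto simp: centr_def)
  \<comment> \<open>The conjugate depends on x alone, which gives uniqueness of the flip; the
    vanishing trace of h gives the claim on squares.\<close>
  have flip: "conjg ?S h x = (d, - b mod p, - c mod p, a)" "p dvd e + k"
    if x: "x \<in> S - Z" "x = (a, b, c, d)" and h: "h \<in> S - centr ?S x" "h = (e, f, g, k)"
      and y: "conjg ?S h x \<in> centr ?S x" for x h a b c d e f g k
  proof -
    obtain A B C D where y': "conjg ?S h x = (A, B, C, D)" by (cases "conjg ?S h x")
    have yS: "conjg ?S h x \<in> S" using S.conjg_closed x h by auto
    have "conjg ?S h x \<otimes>\<^bsub>?S\<^esub> h = h \<otimes>\<^bsub>?S\<^esub> x"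
      by (rule S.conjg_mult_self) (use x h in auto)
    then have hx: "mmul p h x = mmul p (conjg ?S h x) h" by simp
    have m: "p dvd e * a + f * c - A * e - B * g" "p dvd e * b + f * d - A * f - B * k"
      "p dvd g * a + k * c - C * e - D * g" "p dvd g * b + k * d - C * f - D * k"
      using hx unfolding y' unfolding x(2) h(2) mmul_eq_iff by (simp_all add: diff_diff_eq)
    have cm: "p dvd b * C - c * B" "p dvd b * (A - D) - (a - d) * B" "p dvd c * (A - D) - (a - d) * C"
      using y unfolding comm y' unfolding x(2) mmul_commute_iff by auto
    have neq: "\<not> (p dvd A - a \<and> p dvd B - b \<and> p dvd C - c \<and> p dvd D - d)"
    proof
      assume "p dvd A - a \<and> p dvd B - b \<and> p dvd C - c \<and> p dvd D - d"
      then have "conjg ?S h x = x"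
        using mats_eq_iff[of A B C D p a b c d] S_mats[OF yS] S_mats[of x] x y' by auto
      then have "h \<in> centr ?S x" using S.centr_iff_conjg x h by auto
      then show False using h by blast
    qed
    have xS: "(a, b, c, d) \<in> S - Z" and hS: "(e, f, g, k) \<in> S" using x h by auto
    note c = conjugate_in_centralizer[OF p S_det S_det[OF hS] m cm nonscalar[OF xS] regular[OF xS] neq]
    have "(d, - b mod p, - c mod p, a) \<in> mats p"
      using S_mats[of x] x p1 by (auto simp: mats_def)
    moreover have "p dvd B - (- b mod p)" "p dvd C - (- c mod p)"
      using c xS by (simp_all add: mod_eq_dvd_iff[symmetric] mod_simps) (simp_all add: mod_eq_dvd_iff)
    ultimately show "conjg ?S h x = (d, - b mod p, - c mod p, a)"
      using mats_eq_iff[of A B C D p d "- b mod p" "- c mod p" a] S_mats[OF yS] c xS y' by auto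
    show "p dvd e + k" using c xS by blast
  qed
  have scal: "mmul p x x = (1, 0, 0, 1)" if xZ: "x \<in> Z" for x
  proof -
    obtain a where a: "x = (a, 0, 0, a)" "x \<in> S" using xZ unfolding Z_def by blast
    have "mmul p x x = mmul p (1, 0, 0, 1) (1, 0, 0, 1)"
      using S_det[of a 0 0 a] a unfolding a(1) mmul_eq_iff by simp
    then show ?thesis using p1 by simp
  qed
  have "ca_group ?S Z"
  proof (intro ca_group.intro ca_group_axioms.intro)
    show "group ?S" by (rule S.is_group)
    show "finite (carrier ?S)" using finS by simp
    show "subgroup Z ?S"
    proof (rule S.subgroupI)
      show "Z \<subseteq> carrier ?S" by (auto simp: Z_def)
      show "Z \<noteq> {}" using S.one_closed by (auto simp: Z_def)
      fix x assume x: "x \<in> Z"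
      then have "inv\<^bsub>?S\<^esub> x = x" using scal[OF x] by (intro S.inv_equality) (auto simp: Z_def)
      then show "inv\<^bsub>?S\<^esub> x \<in> Z" using x by simp
      fix y assume y: "y \<in> Z"
      have "x \<otimes>\<^bsub>?S\<^esub> y \<in> S" using S.m_closed[of x y] x y by (auto simp: Z_def)
      then show "x \<otimes>\<^bsub>?S\<^esub> y \<in> Z" using x y by (auto simp: Z_def)
    qed
    show "z \<otimes>\<^bsub>?S\<^esub> x = x \<otimes>\<^bsub>?S\<^esub> z" if "z \<in> Z" "x \<in> carrier ?S" for z x
      using that by (cases x) (auto simp: Z_def mult.commute)
    \<comment> \<open>A scalar a of determinant 1 satisfies a^2 = 1; -1 is stored as p - 1. For p =
      2 the two listed matrices coincide.\<close>
    have "Z \<subseteq> {(1, 0, 0, 1), (p - 1, 0, 0, p - 1)}"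
    proof
      fix x assume "x \<in> Z"
      then obtain a where a: "x = (a, 0, 0, a)" "x \<in> S" unfolding Z_def by blast
      have "p dvd a * a - 1" using S_det[of a 0 0 a] a by simp
      then have "p dvd (a - 1) * (a - (p - 1))" by Groebner_Basis.algebra
      then consider "p dvd a - 1" | "p dvd a - (p - 1)" using pm by blast
      then show "x \<in> {(1, 0, 0, 1), (p - 1, 0, 0, p - 1)}"
        using mats_eq_iff[of a 0 0 a p 1 0 0 1] mats_eq_iff[of a 0 0 a p "p - 1" 0 0 "p - 1"]
          S_mats[OF a(2)] p1 a(1) by cases (auto simp: mats_def)
    qed
    then have "card Z \<le> card {(1, 0, 0, 1) :: mat2, (p - 1, 0, 0, p - 1)}" by (intro card_mono) auto
    also have "\<dots> \<le> 2" by (simp add: card_insert_if)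
    finally show "card Z \<le> 2" .
    show "u \<otimes>\<^bsub>?S\<^esub> v = v \<otimes>\<^bsub>?S\<^esub> u"
      if x: "x \<in> carrier ?S - Z" and uv: "u \<in> centr ?S x" "v \<in> centr ?S x" for x u v
    proof -
      obtain a b c d e f g h i j k l where *: "x = (a, b, c, d)" "u = (e, f, g, h)" "v = (i, j, k, l)"
        by (cases x; cases u; cases v) auto
      have "p dvd b * g - c * f" "p dvd b * (e - h) - (a - d) * f" "p dvd c * (e - h) - (a - d) * g"
        "p dvd b * k - c * j" "p dvd b * (i - l) - (a - d) * j" "p dvd c * (i - l) - (a - d) * k"
        using uv unfolding comm * mmul_commute_iff by auto
      from cross_products_vanish[OF p nonscalar this] x *
      have "mmul p u v = mmul p v u" unfolding * mmul_commute_iff by auto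
      then show ?thesis by simp
    qed
    show "conjg ?S h x = conjg ?S k x"
      if x: "x \<in> carrier ?S - Z" and h: "h \<in> carrier ?S - centr ?S x" "conjg ?S h x \<in> centr ?S x"
        and k: "k \<in> carrier ?S - centr ?S x" "conjg ?S k x \<in> centr ?S x" for x h k
    proof -
      obtain a b c d e f g j e' f' g' j' where *: "x = (a, b, c, d)" "h = (e, f, g, j)" "k = (e', f', g', j')"
        by (cases x; cases h; cases k) auto
      have "x \<in> S - Z" "h \<in> S - centr ?S x" "k \<in> S - centr ?S x" using x h k by auto
      then show ?thesis
        using flip(1)[OF _ *(1) _ *(2) h(2)] flip(1)[OF _ *(1) _ *(3) k(2)] by (simp only:)
    qed
    show "h \<otimes>\<^bsub>?S\<^esub> h \<in> Z - {\<one>\<^bsub>?S\<^esub>}"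
      if x: "x \<in> carrier ?S - Z" and h: "h \<in> carrier ?S - centr ?S x" 
        and y: "conjg ?S h x \<in> centr ?S x" for x h
    proof -
      obtain a b c d e f g k where *: "x = (a, b, c, d)" "h = (e, f, g, k)" by (cases x; cases h) auto
      have ek: "p dvd e + k" using flip(2)[of x a b c d h e f g k] x h y * by simp
      have dh: "p dvd e * k - f * g - 1" using S_det[of e f g k] h * by simp
      have "mmul p h h = mmul p (p - 1, 0, 0, p - 1) (1, 0, 0, 1)"
      proof -
        have "p dvd e * e + f * g - (p - 1)" "p dvd e * f + f * k" "p dvd g * e + k * g"
          "p dvd g * f + k * k - (p - 1)"
          using ek dh by Groebner_Basis.algebra+
        then show ?thesis unfolding * mmul_eq_iff by simp
      qed
      then have hh: "mmul p h h = (p - 1, 0, 0, p - 1)" using p1 by (simp add: zmod_minus1)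
      have "mmul p h h \<in> S" using S.m_closed[of h h] h by simp
      then have "mmul p h h \<in> Z" using hh by (auto simp: Z_def)
      \<comment> \<open>Only for p = 2 is -1 equal to 1. Then h would be an involution in a group of
        odd order.\<close>
      moreover have "mmul p h h \<noteq> (1, 0, 0, 1)"
      proof
        assume one: "mmul p h h = (1, 0, 0, 1)"
        then have p2: "p = 2" using hh by simp
        have "h [^]\<^bsub>?S\<^esub> (2::nat) = \<one>\<^bsub>?S\<^esub>" using one h S.l_one[of h] by (simp add: numeral_2_eq_2)
        then have "S.ord h dvd 2" using S.pow_eq_id[of h 2] h by simp
        moreover have "S.ord h \<noteq> 1"
          using S.ord_eq_1[of h] h x by (auto simp: centr_def mats_def dest!: S_mats)
        ultimately have "S.ord h = 2" using two_is_prime_nat prime_nat_iff by blast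
        then have "2 dvd card S" using S.ord_dvd_group_order[of h] h by (simp add: order_def)
        then show False using coprime p2 by simp
      qed
      ultimately show ?thesis by simp
    qed
    show "\<not> 8 dvd order ?S" using n8 by (simp add: order_def)
  qed
  then have "solvable ?S" by (rule ca_group.solvable)
  then show ?thesis using GL.solvable_subgroup_iff[OF S] by blast
qed

lemma GL2_commutator_mult:
  assumes p: "Factorial_Ring.prime p" and "u \<in> carrier (GL2 p)" "v \<in> carrier (GL2 p)"
  shows "mmul p (u \<otimes>\<^bsub>GL2 p\<^esub> v \<otimes>\<^bsub>GL2 p\<^esub> inv\<^bsub>GL2 p\<^esub> u \<otimes>\<^bsub>GL2 p\<^esub> inv\<^bsub>GL2 p\<^esub> v) (mmul p v u) = mmul p u v"
proof -
  interpret GL: group "GL2 p" using group_GL2[OF p] .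
  show ?thesis using GL.commutator_mult[OF assms(2,3)] by simp
qed

text \<open>The determinant is multiplicative with commuting values, so all commutators of
  \<open>L\<close> lie in its determinant-1 part \<open>S\<close>.\<close>

lemma GL2_regular_subgroup_solvable:
  assumes p: "Factorial_Ring.prime p" and L: "subgroup L (GL2 p)"
    and coprime: "\<not> p dvd int (card L)" and n8: "\<not> 8 dvd card L"
  shows "solvable_seq (GL2 p) L"
proof -
  interpret GL: group "GL2 p" using group_GL2[OF p] .
  note pm = prime_dvd_mult_iff[OF p]
  define S where "S = {x \<in> L. p dvd mdet x - 1}"
  have mul: "p dvd mdet (mmul p x y) - mdet x * mdet y" for x y
    using mdet_mmul[of p x y] by (simp add: mod_eq_dvd_iff)
  have S: "subgroup S (GL2 p)"
  proof (rule GL.subgroupI)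
    show "S \<subseteq> carrier (GL2 p)" using subgroup.subset[OF L] by (auto simp: S_def)
    have "(1, 0, 0, 1) \<in> S" using subgroup.one_closed[OF L] by (simp add: S_def)
    then show "S \<noteq> {}" by blast
    fix x assume x: "x \<in> S"
    then have xL: "x \<in> L" "p dvd mdet x - 1" by (auto simp: S_def)
    let ?y = "inv\<^bsub>GL2 p\<^esub> x"
    have "mmul p ?y x = (1, 0, 0, 1)" using GL.l_inv subgroup.mem_carrier[OF L xL(1)] by simp
    then have "p dvd 1 - mdet ?y * mdet x" using mul[of ?y x] by simp
    then have "p dvd mdet ?y - 1" using xL(2) by Groebner_Basis.algebra
    then show "?y \<in> S" using subgroup.m_inv_closed[OF L xL(1)] by (simp add: S_def)
    fix y assume y: "y \<in> S"
    then have yL: "y \<in> L" "p dvd mdet y - 1" by (auto simp: S_def)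
    have "p dvd mdet (mmul p x y) - 1" using mul[of x y] xL(2) yL(2) by Groebner_Basis.algebra
    then show "x \<otimes>\<^bsub>GL2 p\<^esub> y \<in> S" using subgroup.m_closed[OF L xL(1) yL(1)] by (simp add: S_def)
  qed
  have dvd: "card S dvd card L" using GL.card_subgroup_dvd[OF S L] by (auto simp: S_def)
  have "solvable_seq (GL2 p) S"
  proof (rule SL2_subgroup_solvable[OF p S])
    show "p dvd mdet x - 1" if "x \<in> S" for x using that by (simp add: S_def)
    show "\<not> p dvd int (card S)" using coprime dvd dvd_trans[of p "int (card S)" "int (card L)"] by auto
    show "\<not> 8 dvd card S" using n8 dvd dvd_trans by blast
  qed
  then show ?thesis
  proof (rule GL.commutators_imp_solvable_seq[OF L])
    fix u v assume uv: "u \<in> L" "v \<in> L"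
    let ?c = "u \<otimes>\<^bsub>GL2 p\<^esub> v \<otimes>\<^bsub>GL2 p\<^esub> inv\<^bsub>GL2 p\<^esub> u \<otimes>\<^bsub>GL2 p\<^esub> inv\<^bsub>GL2 p\<^esub> v"
    have "?c \<in> L" using uv by (meson L subgroup.m_closed subgroup.m_inv_closed)
    moreover have "p dvd mdet ?c - 1"
    proof -
      have uc: "u \<in> carrier (GL2 p)" "v \<in> carrier (GL2 p)" using subgroup.mem_carrier[OF L] uv by auto
      define t where "t = mdet ?c"
      have "p dvd mdet (mmul p u v) - t * mdet (mmul p v u)"
        using mul[of ?c "mmul p v u"] unfolding GL2_commutator_mult[OF p uc] t_def .
      then have "p dvd mdet u * mdet v * (t - 1)"
        using mul[of u v] mul[of v u] by Groebner_Basis.algebra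
      then show ?thesis using uc pm by (auto simp: t_def)
    qed
    ultimately show "?c \<in> S" by (simp add: S_def)
  qed
qed

text \<open>Diagonal entries of triangular matrices multiply, so commutators are unipotent, and
  upper unipotent matrices commute with each other.\<close>

lemma GL2_triangular_solvable:
  assumes p: "Factorial_Ring.prime p" and L: "subgroup L (GL2 p)"
    and tri: "\<And>a b c d. (a, b, c, d) \<in> L \<Longrightarrow> c = 0"
  shows "solvable_seq (GL2 p) L"
proof -
  interpret GL: group "GL2 p" using group_GL2[OF p] .
  note pm = prime_dvd_mult_iff[OF p]
  have p1: "p > 1" using p prime_gt_1_int by blast
  define U where "U = {x \<in> L. \<exists>b. x = (1, b, 0, 1)}"
  have UI: "x \<in> U" if "x \<in> L" "x = (a, b, c, d)" "p dvd a - 1" "p dvd d - 1" for x a b c d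
  proof -
    have "x \<in> mats p" using subgroup.mem_carrier[OF L that(1)] by simp
    then have "(a, b, c, d) = (1, b, 0, 1)"
      using mats_eq_iff[of a b c d p 1 b 0 1] that tri[of a b c d] p1 by (auto simp: mats_def)
    then show ?thesis using that by (simp add: U_def)
  qed
  have U: "subgroup U (GL2 p)"
  proof (rule GL.subgroupI)
    show "U \<subseteq> carrier (GL2 p)" using subgroup.subset[OF L] by (auto simp: U_def)
    show "U \<noteq> {}" using subgroup.one_closed[OF L] by (auto simp: U_def)
    fix x assume x: "x \<in> U"
    then obtain b where xb: "x = (1, b, 0, 1)" and xL: "x \<in> L" unfolding U_def by blast
    obtain e f g h where y: "inv\<^bsub>GL2 p\<^esub> x = (e, f, g, h)" by (cases "inv\<^bsub>GL2 p\<^esub> x")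
    have yL: "inv\<^bsub>GL2 p\<^esub> x \<in> L" using subgroup.m_inv_closed[OF L xL] .
    then have g: "g = 0" using y tri by auto
    have "mmul p (inv\<^bsub>GL2 p\<^esub> x) x = (1, 0, 0, 1)" using GL.l_inv subgroup.mem_carrier[OF L xL] by simp
    then have "e mod p = 1 mod p" "h mod p = 1 mod p" using p1 unfolding y unfolding xb g by auto
    then show "inv\<^bsub>GL2 p\<^esub> x \<in> U" using UI[OF yL y] by (simp add: mod_eq_dvd_iff)
    fix y assume "y \<in> U"
    then obtain b' where yb: "y = (1, b', 0, 1)" and yL: "y \<in> L" unfolding U_def by blast
    show "x \<otimes>\<^bsub>GL2 p\<^esub> y \<in> U"
      using subgroup.m_closed[OF L xL yL] p1 by (auto simp: U_def xb yb)
  qed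
  have "solvable_seq (GL2 p) U"
    by (rule GL.commuting_imp_solvable_seq[OF U]) (auto simp: U_def add.commute)
  then show ?thesis
  proof (rule GL.commutators_imp_solvable_seq[OF L])
    fix u v assume uv: "u \<in> L" "v \<in> L"
    let ?c = "u \<otimes>\<^bsub>GL2 p\<^esub> v \<otimes>\<^bsub>GL2 p\<^esub> inv\<^bsub>GL2 p\<^esub> u \<otimes>\<^bsub>GL2 p\<^esub> inv\<^bsub>GL2 p\<^esub> v"
    have cL: "?c \<in> L" using uv by (meson L subgroup.m_closed subgroup.m_inv_closed)
    obtain a b c d where u: "u = (a, b, c, d)" by (cases u)
    obtain e f g h where v: "v = (e, f, g, h)" by (cases v)
    obtain i j k l where w: "?c = (i, j, k, l)" by (cases ?c)
    have z: "c = 0" "g = 0" "k = 0" using tri uv cL u v w by metis+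
    have uc: "u \<in> carrier (GL2 p)" "v \<in> carrier (GL2 p)" using subgroup.mem_carrier[OF L] uv by auto
    then have nz: "\<not> p dvd a" "\<not> p dvd d" "\<not> p dvd e" "\<not> p dvd h" using u v z pm by auto
    have "mmul p ?c (mmul p v u) = mmul p u v" using GL2_commutator_mult[OF p uc] .
    then have "(i * (e * a)) mod p = (a * e) mod p" "(l * (h * d)) mod p = (d * h) mod p"
      unfolding w unfolding u v z by (simp_all add: mod_dot mod_mult_right_eq)
    then have "p dvd i * (e * a) - a * e" "p dvd l * (h * d) - d * h" by (simp_all add: mod_eq_dvd_iff)
    then have "p dvd a * e * (i - 1)" "p dvd d * h * (l - 1)" by (simp_all add: algebra_simps)
    then have "p dvd i - 1" "p dvd l - 1" using nz pm by blast+
    then show "?c \<in> U" using UI[OF cL w] by blast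
  qed
qed

section \<open>The order of GL(2,p)\<close>

text \<open>The second columns proportional to a given nonzero first column form a line. If a is a
  unit, b determines d; otherwise b = 0 and d is free.\<close>

lemma card_proportional:
  fixes p :: int
  assumes p: "Factorial_Ring.prime p" and ac: "a \<in> {0..<p}" "c \<in> {0..<p}" "(a, c) \<noteq> (0, 0)"
  shows "card {(b, d). b \<in> {0..<p} \<and> d \<in> {0..<p} \<and> p dvd a * d - b * c} = nat p" (is "card ?K = _")
proof (cases "a = 0")
  case True
  then have "\<not> p dvd c" using ac by (auto dest: zdvd_imp_le)
  then have "?K = {0} \<times> {0..<p}"
    using True prime_dvd_mult_iff[OF p] prime_gt_1_int[OF p] by (auto dest: zdvd_imp_le)
  then show ?thesis by (simp add: card_cartesian_product)
next
  case False
  then have na: "\<not> p dvd a" using ac by (auto dest: zdvd_imp_le)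
  then have "coprime p a" using p by (simp add: prime_imp_coprime)
  then obtain q r where "q * a + r * p = 1"
    using bezout_int[of a p] by (auto simp: coprime_commute coprime_iff_gcd_eq_1)
  then have q: "p dvd q * a - 1" by Groebner_Basis.algebra
  have p1: "p > 1" using p prime_gt_1_int by blast
  have iff: "p dvd a * d - b * c \<longleftrightarrow> d = (q * b * c) mod p" if "d \<in> {0..<p}" for b d
  proof -
    have "p dvd a * d - b * c \<longleftrightarrow> p dvd d - q * b * c"
    proof
      assume "p dvd a * d - b * c"
      then show "p dvd d - q * b * c" using q by Groebner_Basis.algebra
    next
      assume "p dvd d - q * b * c"
      then show "p dvd a * d - b * c" using q by Groebner_Basis.algebra
    qed
    also have "\<dots> \<longleftrightarrow> d mod p = (q * b * c) mod p" by (simp add: mod_eq_dvd_iff)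
    finally show ?thesis using that by simp
  qed
  have "?K = (\<lambda>b. (b, (q * b * c) mod p)) ` {0..<p}" using iff p1 by auto
  moreover have "inj_on (\<lambda>b. (b, (q * b * c) mod p)) {0..<p}" by (auto simp: inj_on_def)
  ultimately show ?thesis by (simp add: card_image)
qed

text \<open>Chooses a nonzero first column (a, c) and then a second column (b, d) off its
  line.\<close>

lemma order_GL2:
  assumes p: "Factorial_Ring.prime p"
  shows "order (GL2 p) = ((nat p)\<^sup>2 - 1) * ((nat p)\<^sup>2 - nat p)"
proof -
  let ?F = "{0..<p} \<times> {0..<p}"
  have p1: "p > 1" using p prime_gt_1_int by blast
  let ?N = "\<lambda>(a, c). {(b, d). b \<in> {0..<p} \<and> d \<in> {0..<p} \<and> \<not> p dvd a * d - b * c}"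
  have cN: "card (?N ac) = (nat p)\<^sup>2 - nat p" if ac: "ac \<in> ?F - {(0, 0)}" for ac
  proof -
    obtain a c where [simp]: "ac = (a, c)" by (cases ac)
    let ?K = "{(b, d). b \<in> {0..<p} \<and> d \<in> {0..<p} \<and> p dvd a * d - b * c}"
    have "?N ac = ?F - ?K" by auto
    moreover have "?K \<subseteq> ?F" by auto
    moreover have "card ?K = nat p" using card_proportional[OF p, of a c] ac by auto
    ultimately show ?thesis
      using card_Diff_subset[of ?K ?F] finite_subset[of ?K ?F]
      by (simp add: card_cartesian_product power2_eq_square)
  qed
  have "bij_betw (\<lambda>((a, c), (b, d)). (a, b, c, d)) (Sigma (?F - {(0, 0)}) ?N) (carrier (GL2 p))"
    by (rule bij_betw_byWitness[where f' = "\<lambda>(a, b, c, d). ((a, c), (b, d))"])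
       (auto simp: mats_def)
  then have "order (GL2 p) = card (Sigma (?F - {(0, 0)}) ?N)"
    by (simp add: order_def bij_betw_same_card)
  also have "\<dots> = (\<Sum>ac\<in>?F - {(0, 0)}. card (?N ac))"
    by (intro card_SigmaI) (auto intro: finite_subset[of _ ?F])
  also have "\<dots> = card (?F - {(0, 0)}) * ((nat p)\<^sup>2 - nat p)" using cN by simp
  also have "card (?F - {(0, 0)}) = (nat p)\<^sup>2 - 1"
    using p1 by (simp add: card_cartesian_product power2_eq_square)
  finally show ?thesis .
qed

text \<open>The order is p times (p^2 - 1)(p - 1), and the cofactor is 1 modulo p.\<close>

lemma prime_square_not_dvd_GL2:
  assumes p: "Factorial_Ring.prime (p::nat)"
  shows "\<not> p\<^sup>2 dvd order (GL2 (int p))"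
proof
  assume *: "p\<^sup>2 dvd order (GL2 (int p))"
  have p2: "p \<ge> 2" using p prime_ge_2_nat by blast
  have "order (GL2 (int p)) = (p\<^sup>2 - 1) * (p\<^sup>2 - p)" using order_GL2[of "int p"] p by simp
  also have "\<dots> = p * ((p\<^sup>2 - 1) * (p - 1))"
    by (simp add: power2_eq_square algebra_simps diff_mult_distrib2)
  finally have "p dvd (p\<^sup>2 - 1) * (p - 1)" using * p2 by (simp add: power2_eq_square)
  then consider "p dvd p\<^sup>2 - 1" | "p dvd p - 1" using p prime_dvd_mult_iff by blast
  then have "p dvd 1"
  proof cases
    case 1
    then show ?thesis using p2 dvd_diffD1[of p "p\<^sup>2" 1] by (simp add: power2_eq_square)
  next
    case 2
    then show ?thesis using p2 dvd_diffD1[of p p 1] by simp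
  qed
  then show False using p2 by simp
qed

section \<open>Actions on elementary abelian groups of rank two\<close>

lemma (in group_hom) card_image_kernel:
  "card (h ` carrier G) * card (kernel G H h) = order G"
proof -
  let ?I = "H\<lparr>carrier := h ` carrier G\<rparr>"
  interpret I: group ?I using H.subgroup_imp_group[OF img_is_subgroup] .
  interpret hI: group_hom G ?I h
    by unfold_locales (auto simp: hom_def)
  have k: "kernel G ?I h = kernel G H h" by (simp add: kernel_def)
  have "bij_betw (\<lambda>Y. the_elem (h ` Y)) (carrier (G Mod kernel G ?I h)) (h ` carrier G)"
    using hI.FactGroup_iso_set by (simp add: iso_def)
  then have "card (rcosets (kernel G H h)) = card (h ` carrier G)"
    unfolding k by (auto simp: FactGroup_def dest: bij_betw_same_card)
  then show ?thesis using G.lagrange[OF subgroup_kernel] by simp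
qed

lemma (in group_hom) solvable_of_kernel_and_image:
  assumes "solvable_seq G (kernel G H h)" "solvable_seq H (h ` carrier G)"
  shows "solvable G"
proof -
  have "group_hom G G id" by unfold_locales (auto simp: hom_def)
  then show ?thesis
    using solvable_seq_condition[of G G id H h "kernel G H h" "carrier G"] assms
      group_hom_axioms G.subgroup_self by (auto simp: solvable_def kernel_def)
qed

lemma (in group) ord_prime:
  assumes "Factorial_Ring.prime (p::nat)" "x \<in> carrier G" "x [^] p = \<one>" "x \<noteq> \<one>"
  shows "ord x = p"
proof -
  have "ord x dvd p" using assms pow_eq_id by blast
  moreover have "ord x \<noteq> 1" using assms ord_eq_1 by blast
  ultimately show ?thesis using assms(1) prime_nat_iff by blast
qed

lemma (in group) powers_of_prime_order:
  assumes p: "Factorial_Ring.prime (p::nat)" and x: "x \<in> carrier G" "x [^] p = \<one>" "x \<noteq> \<one>"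
  shows "card (range (\<lambda>a::int. x [^] a)) = p"
proof -
  have eq: "x [^] a = x [^] b \<longleftrightarrow> int p dvd b - a" for a b :: int
    using int_pow_eq[OF x(1)] ord_prime[OF assms] by simp
  have p0: "int p > 0" using p prime_gt_0_nat by simp
  have "inj_on (\<lambda>a::int. x [^] a) {0..<int p}"
    by (rule inj_onI) (auto simp: eq mod_eq_dvd_iff[symmetric])
  moreover have "x [^] a \<in> (\<lambda>a::int. x [^] a) ` {0..<int p}" for a :: int
    by (rule image_eqI[of _ _ "a mod int p"]) (use p0 in \<open>simp_all add: eq mod_eq_dvd_iff[symmetric]\<close>)
  then have "range (\<lambda>a::int. x [^] a) = (\<lambda>a::int. x [^] a) ` {0..<int p}" by auto
  ultimately show ?thesis by (simp add: card_image)
qed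

section \<open>Coordinates in a plane and matrices of an action\<close>

locale prime_plane = comm_group V for V (structure) +
  fixes p :: nat
  assumes prime: "Factorial_Ring.prime p"
    and exponent: "x \<in> carrier V \<Longrightarrow> x [^] p = \<one>"
    and fin: "finite (carrier V)"
    and order: "order V = p\<^sup>2"
begin

abbreviation "line v \<equiv> range (\<lambda>a::int. v [^] a)"

lemma pow_eq_iff:
  assumes "v \<in> carrier V" "v \<noteq> \<one>"
  shows "v [^] (a::int) = v [^] (b::int) \<longleftrightarrow> int p dvd b - a"
  using int_pow_eq[OF assms(1)] ord_prime[OF prime assms(1) exponent assms(2)] assms(1) by simp

lemma pow_mod: "x \<in> carrier V \<Longrightarrow> x [^] (a mod int p) = x [^] (a::int)"
  by (cases "x = \<one>") (simp_all add: pow_eq_iff mod_eq_dvd_iff[symmetric])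

text \<open>Any w off the line of v works: if b were a unit in a relation, w would be a power of v.
  Independence makes the p^2 reduced combinations distinct, and they exhaust V by counting.\<close>

lemma basis_exists:
  assumes v: "v \<in> carrier V" "v \<noteq> \<one>"
  obtains w where "w \<in> carrier V"
    "\<And>a b. v [^] (a::int) \<otimes> w [^] (b::int) = \<one> \<Longrightarrow> int p dvd a \<and> int p dvd b"
    "\<And>x. x \<in> carrier V \<Longrightarrow> \<exists>(a::int) b::int. x = v [^] a \<otimes> w [^] b"
proof -
  have p1: "p > 1" using prime prime_gt_1_nat by blast
  have "card (line v) < card (carrier V)"
    using powers_of_prime_order[OF prime v(1) exponent[OF v(1)] v(2)] order p1
    by (simp add: order_def power2_eq_square)
  then have "\<not> carrier V \<subseteq> line v"
    using card_mono[of "line v" "carrier V"] finite_subset[of "line v" "carrier V"] fin v(1)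
    by auto
  then obtain w where w: "w \<in> carrier V" "w \<notin> line v" by blast
  have indep: "int p dvd a \<and> int p dvd b" if ab: "v [^] a \<otimes> w [^] b = \<one>" for a b :: int
  proof -
    have b: "int p dvd b"
    proof (rule ccontr)
      assume "\<not> int p dvd b"
      then have "coprime (int p) b" using prime by (simp add: prime_imp_coprime)
      then obtain q r where qr: "q * b + r * int p = 1"
        using bezout_int[of b "int p"] by (auto simp: coprime_commute coprime_iff_gcd_eq_1)
      have "w [^] b = inv (v [^] a)"
        using ab v w by (metis inv_equality int_pow_closed m_comm)
      then have wb: "w [^] b = v [^] (- a)" using v by (simp add: int_pow_neg)
      have "int p dvd 1 - b * q" using qr by Groebner_Basis.algebra
      then have "w [^] (b * q) = w [^] (1::int)"
        using pow_eq_iff[of w "b * q" 1] w by (cases "w = \<one>") auto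
      then have "w = (w [^] b) [^] q" using w by (simp add: int_pow_pow)
      also have "\<dots> = v [^] (- a * q)" unfolding wb using v by (simp add: int_pow_pow)
      finally show False using w(2) by blast
    qed
    then have "w [^] b = w [^] (0::int)" using w pow_eq_iff[of w b 0] by (cases "w = \<one>") auto
    then have "v [^] a = v [^] (0::int)" using ab v by simp
    then show ?thesis using b pow_eq_iff[OF v, of a 0] by simp
  qed
  define f where "f = (\<lambda>(a::int, b::int). v [^] a \<otimes> w [^] b)"
  let ?F = "{0..<int p} \<times> {0..<int p}"
  have "inj_on f ?F"
  proof (rule inj_onI)
    fix x y assume xy: "x \<in> ?F" "y \<in> ?F" "f x = f y"
    obtain a b c d where [simp]: "x = (a, b)" "y = (c, d)" by (cases x; cases y) auto
    have "v [^] (a - c) \<otimes> w [^] (b - d) = (v [^] a \<otimes> w [^] b) \<otimes> inv (v [^] c \<otimes> w [^] d)"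
      using v w by (simp add: int_pow_diff inv_mult m_ac)
    also have "\<dots> = \<one>" using xy v w by (simp add: f_def)
    finally have "int p dvd a - c" "int p dvd b - d" using indep by blast+
    then show "x = y" using xy by (simp add: mod_eq_dvd_iff[symmetric])
  qed
  then have "card (f ` ?F) = card (carrier V)"
    using order by (simp add: card_image card_cartesian_product power2_eq_square order_def)
  moreover have "f ` ?F \<subseteq> carrier V" using v w by (auto simp: f_def)
  ultimately have "f ` ?F = carrier V" using card_subset_eq[OF fin] by blast
  then have "\<exists>(a::int) b::int. x = v [^] a \<otimes> w [^] b" if "x \<in> carrier V" for x
    using that by (force simp: f_def)
  then show ?thesis using that w indep by blast
qed

end

locale group_action_by_homs = group G + V: comm_group V
  for G (structure) and V (structure) +
  fixes act :: "'a \<Rightarrow> 'c \<Rightarrow> 'c"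
  assumes act_hom: "g \<in> carrier G \<Longrightarrow> act g \<in> hom V V"
    and act_mult: "g \<in> carrier G \<Longrightarrow> h \<in> carrier G \<Longrightarrow> x \<in> carrier V \<Longrightarrow>
          act (g \<otimes>\<^bsub>G\<^esub> h) x = act g (act h x)"
    and act_one: "x \<in> carrier V \<Longrightarrow> act \<one>\<^bsub>G\<^esub> x = x"
begin

definition act_kernel where
  "act_kernel = {g \<in> carrier G. \<forall>x\<in>carrier V. act g x = x}"

lemma act_closed: "g \<in> carrier G \<Longrightarrow> x \<in> carrier V \<Longrightarrow> act g x \<in> carrier V"
  using act_hom by (auto simp: hom_def)

lemma act_group_hom: "g \<in> carrier G \<Longrightarrow> group_hom V V (act g)"
  using act_hom by unfold_locales

lemma act_inv:
  assumes "g \<in> carrier G" "x \<in> carrier V"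
  shows "act g (act (inv\<^bsub>G\<^esub> g) x) = x" "act (inv\<^bsub>G\<^esub> g) (act g x) = x"
  using assms by (simp_all add: act_mult[symmetric] act_one)

text \<open>The chosen v is the first basis vector, so c is the coefficient of the second basis
  vector in \<open>act g v\<close>. An invariant line through v thus makes all matrices upper
  triangular.\<close>

lemma matrix_representation:
  assumes pl: "prime_plane V p" and v: "v \<in> carrier V" "v \<noteq> \<one>\<^bsub>V\<^esub>"
  obtains A where "A \<in> hom G (GL2 (int p))" "kernel G (GL2 (int p)) A = act_kernel"
    "\<And>g a b c d. g \<in> carrier G \<Longrightarrow> A g = (a, b, c, d) \<Longrightarrow>
      act g v \<in> range (\<lambda>a::int. v [^]\<^bsub>V\<^esub> a) \<Longrightarrow> c = 0"
proof -
  interpret P: prime_plane V p by fact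
  have p1: "int p > 1" using P.prime prime_gt_1_nat by simp
  obtain w where w: "w \<in> carrier V"
    and indep: "\<And>a b. v [^]\<^bsub>V\<^esub> (a::int) \<otimes>\<^bsub>V\<^esub> w [^]\<^bsub>V\<^esub> (b::int) = \<one>\<^bsub>V\<^esub> \<Longrightarrow> int p dvd a \<and> int p dvd b"
    and span: "\<And>x. x \<in> carrier V \<Longrightarrow> \<exists>(a::int) b::int. x = v [^]\<^bsub>V\<^esub> a \<otimes>\<^bsub>V\<^esub> w [^]\<^bsub>V\<^esub> b"
    using P.basis_exists[OF v] by blast
  define vec where "vec = (\<lambda>(a::int) (b::int). v [^]\<^bsub>V\<^esub> a \<otimes>\<^bsub>V\<^esub> w [^]\<^bsub>V\<^esub> b)"
  have vec_closed: "vec a b \<in> carrier V" for a b using v w by (simp add: vec_def)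
  have vec_mod: "vec (a mod int p) (b mod int p) = vec a b" for a b
    using v w by (simp add: vec_def P.pow_mod)
  have vec_eq: "vec a b = vec c d \<longleftrightarrow> int p dvd a - c \<and> int p dvd b - d" for a b c d
  proof
    assume eq: "vec a b = vec c d"
    have "v [^]\<^bsub>V\<^esub> (a - c) \<otimes>\<^bsub>V\<^esub> w [^]\<^bsub>V\<^esub> (b - d) = vec a b \<otimes>\<^bsub>V\<^esub> inv\<^bsub>V\<^esub> vec c d"
      using v w by (simp add: vec_def V.int_pow_diff V.inv_mult V.m_ac)
    also have "\<dots> = \<one>\<^bsub>V\<^esub>" using eq vec_closed by simp
    finally show "int p dvd a - c \<and> int p dvd b - d" by (rule indep)
  next
    assume "int p dvd a - c \<and> int p dvd b - d"
    then show "vec a b = vec c d"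
      using vec_mod[of a b] vec_mod[of c d] by (metis mod_eq_dvd_iff)
  qed
  have vec_mult: "vec a b \<otimes>\<^bsub>V\<^esub> vec c d = vec (a + c) (b + d)" for a b c d
    using v w by (simp add: vec_def V.int_pow_mult V.m_ac)
  have vec_pow: "vec a b [^]\<^bsub>V\<^esub> (n::int) = vec (a * n) (b * n)" for a b n
    using v w by (simp add: vec_def V.int_pow_distrib V.int_pow_pow)
  have vec_v: "vec 1 0 = v" and vec_w: "vec 0 1 = w" using v w by (simp_all add: vec_def)
  have act_vec: "act g (vec a b) = act g v [^]\<^bsub>V\<^esub> a \<otimes>\<^bsub>V\<^esub> act g w [^]\<^bsub>V\<^esub> b" if g: "g \<in> carrier G" for g a b
  proof -
    interpret h: group_hom V V "act g" using act_group_hom[OF g] .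
    show ?thesis using v w by (simp add: vec_def h.hom_int_pow)
  qed
  have "\<forall>g\<in>carrier G. \<exists>M. M \<in> mats (int p) \<and>
      (case M of (a, b, c, d) \<Rightarrow> act g v = vec a c \<and> act g w = vec b d)"
  proof
    fix g assume g: "g \<in> carrier G"
    obtain a c b d where "act g v = vec a c" "act g w = vec b d"
      using span[OF act_closed[OF g v(1)]] span[OF act_closed[OF g w]] by (auto simp: vec_def)
    then show "\<exists>M. M \<in> mats (int p) \<and> (case M of (a, b, c, d) \<Rightarrow> act g v = vec a c \<and> act g w = vec b d)"
      using p1 by (intro exI[of _ "(a mod int p, b mod int p, c mod int p, d mod int p)"])
        (simp add: mats_def vec_mod)
  qed
  then obtain A where A: "\<And>g. g \<in> carrier G \<Longrightarrow> A g \<in> mats (int p)"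
    "\<And>g. g \<in> carrier G \<Longrightarrow> case A g of (a, b, c, d) \<Rightarrow> act g v = vec a c \<and> act g w = vec b d"
    by metis
  \<comment> \<open>Coordinates determine the reduced matrix. Stating this for a product of matrices
    serves multiplicativity, the identity and the kernel at once.\<close>
  have A_eq: "A g = mmul (int p) M M'"
    if g: "g \<in> carrier G" and "M = (a, b, c, d)" "M' = (e, f, h, k)"
      "act g v = vec (a * e + b * h) (c * e + d * h)" "act g w = vec (a * f + b * k) (c * f + d * k)"
    for g M M' a b c d e f h k
  proof -
    obtain i j l m where Ag: "A g = (i, j, l, m)" by (cases "A g")
    have "vec (a * e + b * h) (c * e + d * h) = vec i l" "vec (a * f + b * k) (c * f + d * k) = vec j m"
      using A(2)[OF g] that Ag by simp_all
    then have "int p dvd (a * e + b * h) - i" "int p dvd (c * e + d * h) - l"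
      "int p dvd (a * f + b * k) - j" "int p dvd (c * f + d * k) - m"
      unfolding vec_eq by blast+
    then have "mmul (int p) M M' = (i mod int p, j mod int p, l mod int p, m mod int p)"
      using that by (simp add: mod_eq_dvd_iff)
    also have "\<dots> = A g" using A(1)[OF g] Ag by (auto simp: mats_def)
    finally show ?thesis by simp
  qed
  have A_mult: "A (g \<otimes>\<^bsub>G\<^esub> h) = mmul (int p) (A g) (A h)" if g: "g \<in> carrier G" and h: "h \<in> carrier G" for g h
  proof -
    obtain a b c d where Ag: "A g = (a, b, c, d)" by (cases "A g")
    obtain e f k l where Ah: "A h = (e, f, k, l)" by (cases "A h")
    have gv: "act g v = vec a c" "act g w = vec b d" using A(2)[OF g] Ag by auto
    have hv: "act h v = vec e k" "act h w = vec f l" using A(2)[OF h] Ah by auto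
    have "act (g \<otimes>\<^bsub>G\<^esub> h) v = vec (a * e + b * k) (c * e + d * k)"
      "act (g \<otimes>\<^bsub>G\<^esub> h) w = vec (a * f + b * l) (c * f + d * l)"
      using g h v w by (simp_all add: act_mult hv act_vec gv vec_pow vec_mult)
    then show ?thesis using A_eq[OF _ Ag Ah] g h by simp
  qed
  have A_one: "A \<one>\<^bsub>G\<^esub> = (1, 0, 0, 1)"
  proof -
    have "A \<one>\<^bsub>G\<^esub> = mmul (int p) (1, 0, 0, 1) (1, 0, 0, 1)"
      by (rule A_eq) (use v w in \<open>auto simp: act_one vec_v vec_w\<close>)
    then show ?thesis using p1 by simp
  qed
  have A_det: "\<not> int p dvd mdet (A g)" if g: "g \<in> carrier G" for g
  proof
    assume "int p dvd mdet (A g)"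
    then have "int p dvd mdet (A (g \<otimes>\<^bsub>G\<^esub> inv\<^bsub>G\<^esub> g))"
      using g by (simp only: A_mult inv_closed mdet_mmul_dvd dvd_mult2)
    then show False using g p1 by (auto simp: A_one dest: zdvd_imp_le)
  qed
  show ?thesis
  proof
    show "A \<in> hom G (GL2 (int p))"
      using A(1) A_det A_mult by (auto simp: hom_def)
    show "kernel G (GL2 (int p)) A = act_kernel"
    proof (intro equalityI subsetI)
      fix g assume "g \<in> kernel G (GL2 (int p)) A"
      then have g: "g \<in> carrier G" "A g = (1, 0, 0, 1)" by (auto simp: kernel_def)
      have "act g v = v" "act g w = w" using A(2)[OF g(1)] g(2) by (simp_all add: vec_v vec_w)
      then have "act g x = x" if "x \<in> carrier V" for x
        using span[OF that] act_vec[OF g(1)] by (auto simp: vec_def)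
      then show "g \<in> act_kernel" using g by (simp add: act_kernel_def)
    next
      fix g assume "g \<in> act_kernel"
      then have g: "g \<in> carrier G" "act g v = v" "act g w = w" using v w by (auto simp: act_kernel_def)
      have "A g = mmul (int p) (1, 0, 0, 1) (1, 0, 0, 1)"
        by (rule A_eq) (use g in \<open>auto simp: vec_v vec_w\<close>)
      then show "g \<in> kernel G (GL2 (int p)) A" using g p1 by (simp add: kernel_def)
    qed
    fix g a b c d
    assume g: "g \<in> carrier G" and Ag: "A g = (a, b, c, d)"
      and "act g v \<in> range (\<lambda>a::int. v [^]\<^bsub>V\<^esub> a)"
    then obtain e where "act g v = vec e 0" using v w by (auto simp: vec_def)
    then have "int p dvd c" using A(2)[OF g] Ag by (simp add: vec_eq)
    then show "c = 0" using A(1)[OF g] Ag by (auto simp: mats_def dest: zdvd_imp_le)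
  qed
qed

end

context group_action_by_homs
begin

lemma act_kernel_subgroup: "subgroup act_kernel G"
proof (rule subgroupI)
  show "act_kernel \<subseteq> carrier G" "act_kernel \<noteq> {}" using act_one by (auto simp: act_kernel_def)
  fix g assume g: "g \<in> act_kernel"
  then have "act (inv\<^bsub>G\<^esub> g) x = x" if "x \<in> carrier V" for x
    using act_inv(2)[of g x] that by (auto simp: act_kernel_def)
  then show "inv\<^bsub>G\<^esub> g \<in> act_kernel" using g by (simp add: act_kernel_def)
  fix h assume "h \<in> act_kernel"
  then show "g \<otimes>\<^bsub>G\<^esub> h \<in> act_kernel" using g by (simp add: act_kernel_def act_mult)
qed

text \<open>\<open>act g\<close> is surjective, so c acts trivially once cg acts as g does. This
  suits commutators, which turn vu into uv, and conjugates, where (gcg^-1)g = gc.\<close>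

lemma act_kernelI_mult:
  assumes "c \<in> carrier G" "g \<in> carrier G"
    and "\<And>x. x \<in> carrier V \<Longrightarrow> act (c \<otimes>\<^bsub>G\<^esub> g) x = act g x"
  shows "c \<in> act_kernel"
proof -
  have "act c x = x" if x: "x \<in> carrier V" for x
  proof -
    let ?y = "act (inv\<^bsub>G\<^esub> g) x"
    have y: "?y \<in> carrier V" using assms x by (simp add: act_closed)
    have "act c (act g ?y) = act g ?y" using assms(3)[OF y] assms(1,2) y by (simp add: act_mult)
    then show ?thesis using act_inv(1) assms x by simp
  qed
  then show ?thesis using assms by (simp add: act_kernel_def)
qed

end

section \<open>Crossed homomorphisms into groups of order p and p^2\<close>

locale crossed_hom = group_action_by_homs +
  fixes \<pi>
  assumes crossed_closed: "g \<in> carrier G \<Longrightarrow> \<pi> g \<in> carrier V"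
    and crossed_mult: "g \<in> carrier G \<Longrightarrow> h \<in> carrier G \<Longrightarrow>
          \<pi> (g \<otimes>\<^bsub>G\<^esub> h) = \<pi> g \<otimes>\<^bsub>V\<^esub> act g (\<pi> h)"
begin

text \<open>The analogue of a kernel, in general not normal. In the application it is the preimage
  in G of the subgroup M.\<close>

definition zeros where "zeros = {g \<in> carrier G. \<pi> g = \<one>\<^bsub>V\<^esub>}"

lemma crossed_hom_act_kernel: "group_hom (G\<lparr>carrier := act_kernel\<rparr>) V \<pi>"
proof -
  interpret C: group "G\<lparr>carrier := act_kernel\<rparr>" using subgroup_imp_group[OF act_kernel_subgroup] .
  show ?thesis
    by unfold_locales (auto simp: hom_def act_kernel_def crossed_mult crossed_closed)
qed

lemma kernel_act_kernel: "kernel (G\<lparr>carrier := act_kernel\<rparr>) V \<pi> = act_kernel \<inter> zeros"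
  by (auto simp: kernel_def zeros_def act_kernel_def)

text \<open>On \<open>act_kernel\<close> the twist in \<open>crossed_mult\<close> is trivial, so
  \<open>\<pi>\<close> is a homomorphism into an abelian group and sends commutators to the
  identity.\<close>

lemma solvable_act_kernel:
  assumes "solvable_seq G zeros"
  shows "solvable_seq G act_kernel"
proof -
  interpret h: group_hom "G\<lparr>carrier := act_kernel\<rparr>" V \<pi> using crossed_hom_act_kernel .
  have sub: "subgroup (act_kernel \<inter> zeros) G"
    using act_kernel_subgroup solvable_imp_subgroup[OF assms] by (rule subgroups_Inter_pair)
  have "solvable_seq G (act_kernel \<inter> zeros)"
    using solvable_seq_mono[OF assms sub] by blast
  then show ?thesis
  proof (rule commutators_imp_solvable_seq[OF act_kernel_subgroup])
    fix u v assume uv: "u \<in> act_kernel" "v \<in> act_kernel"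
    let ?c = "u \<otimes>\<^bsub>G\<^esub> v \<otimes>\<^bsub>G\<^esub> inv\<^bsub>G\<^esub> u \<otimes>\<^bsub>G\<^esub> inv\<^bsub>G\<^esub> v"
    have carr: "u \<in> carrier G" "v \<in> carrier G" using uv by (auto simp: act_kernel_def)
    have c: "?c \<in> act_kernel"
      using uv act_kernel_subgroup by (meson subgroup.m_closed subgroup.m_inv_closed)
    have vu: "v \<otimes>\<^bsub>G\<^esub> u \<in> act_kernel" using uv act_kernel_subgroup by (meson subgroup.m_closed)
    have pi: "\<pi> u \<in> carrier V" "\<pi> v \<in> carrier V" "\<pi> ?c \<in> carrier V"
      using carr by (simp_all add: crossed_closed)
    have "\<pi> ?c \<otimes>\<^bsub>V\<^esub> \<pi> (v \<otimes>\<^bsub>G\<^esub> u) = \<pi> (u \<otimes>\<^bsub>G\<^esub> v)"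
      using h.hom_mult[of ?c "v \<otimes>\<^bsub>G\<^esub> u"] c vu commutator_mult[OF carr] by simp
    then have "\<pi> ?c \<otimes>\<^bsub>V\<^esub> (\<pi> u \<otimes>\<^bsub>V\<^esub> \<pi> v) = \<pi> u \<otimes>\<^bsub>V\<^esub> \<pi> v"
      using h.hom_mult[of u v] h.hom_mult[of v u] uv pi by (simp add: V.m_comm)
    then have "\<pi> ?c = \<one>\<^bsub>V\<^esub>" using pi by (simp add: V.l_cancel_one)
    then show "?c \<in> act_kernel \<inter> zeros" using c carr by (simp add: zeros_def)
  qed
qed

text \<open>Endomorphisms of a cyclic group are power maps and commute with each other; hence
  commutators of G act trivially.\<close>

lemma solvable_cyclic_plane:
  assumes p: "Factorial_Ring.prime p" and order: "order V = p"
    and zeros: "solvable_seq G zeros"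
  shows "solvable G"
  unfolding solvable_def
proof (rule commutators_imp_solvable_seq[OF subgroup_self solvable_act_kernel[OF zeros]])
  have "order V > 1" using order prime_gt_1_nat[OF p] by simp
  then obtain v where v: "v \<in> carrier V" "v \<noteq> \<one>\<^bsub>V\<^esub>"
    using V.order_one_triv_iff by (metis V.one_closed less_irrefl subsetI subset_singletonD insertCI empty_iff singletonD insertE subset_antisym)
  have fin: "finite (carrier V)" using \<open>order V > 1\<close> V.order_gt_0_iff_finite by simp
  have "v [^]\<^bsub>V\<^esub> p = \<one>\<^bsub>V\<^esub>" using V.pow_order_eq_1[OF v(1)] order fin by simp
  then have "card (range (\<lambda>a::int. v [^]\<^bsub>V\<^esub> a)) = card (carrier V)"
    using V.powers_of_prime_order[OF p v(1) _ v(2)] order by (simp add: order_def)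
  then have gen: "range (\<lambda>a::int. v [^]\<^bsub>V\<^esub> a) = carrier V"
    using v fin by (intro card_subset_eq) auto
  fix g h assume g: "g \<in> carrier G" and h: "h \<in> carrier G"
  let ?c = "g \<otimes>\<^bsub>G\<^esub> h \<otimes>\<^bsub>G\<^esub> inv\<^bsub>G\<^esub> g \<otimes>\<^bsub>G\<^esub> inv\<^bsub>G\<^esub> h"
  have pow: "\<exists>a::int. \<forall>x\<in>carrier V. act u x = x [^]\<^bsub>V\<^esub> a" if u: "u \<in> carrier G" for u
  proof -
    interpret au: group_hom V V "act u" using act_group_hom[OF u] .
    obtain a :: int where a: "act u v = v [^]\<^bsub>V\<^esub> a" using gen act_closed[OF u v(1)] by blast
    have "act u x = x [^]\<^bsub>V\<^esub> a" if "x \<in> carrier V" for x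
    proof -
      obtain b :: int where "x = v [^]\<^bsub>V\<^esub> b" using gen \<open>x \<in> carrier V\<close> by blast
      then show ?thesis using v a by (simp add: au.hom_int_pow V.int_pow_pow mult.commute)
    qed
    then show ?thesis by blast
  qed
  obtain a b :: int where ab: "\<And>x. x \<in> carrier V \<Longrightarrow> act g x = x [^]\<^bsub>V\<^esub> a"
    "\<And>x. x \<in> carrier V \<Longrightarrow> act h x = x [^]\<^bsub>V\<^esub> b"
    using pow[OF g] pow[OF h] by blast
  show "?c \<in> act_kernel"
  proof (rule act_kernelI_mult[of _ "h \<otimes>\<^bsub>G\<^esub> g"])
    show "act (?c \<otimes>\<^bsub>G\<^esub> (h \<otimes>\<^bsub>G\<^esub> g)) x = act (h \<otimes>\<^bsub>G\<^esub> g) x" if "x \<in> carrier V" for x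
      unfolding commutator_mult[OF g h]
      using that g h by (simp add: act_mult ab V.int_pow_pow mult.commute)
  qed (use g h in auto)
qed

text \<open>For c acting trivially, so does its conjugate d = gcg^-1. Evaluating
  \<open>\<pi>\<close> on dg = gc in both ways and cancelling \<open>\<pi> g\<close> in the abelian
  V identifies \<open>\<pi> d\<close> with \<open>act g (\<pi> c)\<close>.\<close>

lemma image_act_kernel_invariant:
  assumes g: "g \<in> carrier G" and t: "t \<in> \<pi> ` act_kernel"
  shows "act g t \<in> \<pi> ` act_kernel"
proof -
  obtain c where c: "c \<in> act_kernel" and tc: "t = \<pi> c" using t by blast
  have cc: "c \<in> carrier G" using c by (simp add: act_kernel_def)
  let ?d = "g \<otimes>\<^bsub>G\<^esub> c \<otimes>\<^bsub>G\<^esub> inv\<^bsub>G\<^esub> g"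
  have dg: "?d \<otimes>\<^bsub>G\<^esub> g = g \<otimes>\<^bsub>G\<^esub> c" using g cc by (simp add: m_assoc)
  have d: "?d \<in> act_kernel"
  proof (rule act_kernelI_mult[of _ g])
    show "act (?d \<otimes>\<^bsub>G\<^esub> g) x = act g x" if "x \<in> carrier V" for x
      unfolding dg using that g c cc by (simp add: act_mult act_kernel_def)
  qed (use g cc in auto)
  then have dc: "?d \<in> carrier G" by (simp add: act_kernel_def)
  have "\<pi> ?d \<otimes>\<^bsub>V\<^esub> \<pi> g = \<pi> g \<otimes>\<^bsub>V\<^esub> act g t"
    using crossed_mult[OF dc g] crossed_mult[OF g cc] d crossed_closed[OF g] tc dg
    by (simp add: act_kernel_def)
  then have "\<pi> g \<otimes>\<^bsub>V\<^esub> \<pi> ?d = \<pi> g \<otimes>\<^bsub>V\<^esub> act g t"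
    using crossed_closed[OF g] crossed_closed[OF dc] by (simp add: V.m_comm)
  then have "\<pi> ?d = act g t"
    using crossed_closed[OF g] crossed_closed[OF dc] act_closed[OF g] crossed_closed[OF cc] tc by simp
  then show ?thesis using d by (metis imageI)
qed

lemma solvable_plane:
  assumes pl: "prime_plane V p" and fin: "finite (carrier G)" and cf: "cube_free (order G)"
    and index: "order G = order V * card zeros" and zeros: "solvable_seq G zeros"
  shows "solvable G"
proof -
  interpret P: prime_plane V p by fact
  interpret h: group_hom "G\<lparr>carrier := act_kernel\<rparr>" V \<pi> using crossed_hom_act_kernel .
  let ?T = "\<pi> ` act_kernel" and ?K = "act_kernel \<inter> zeros"
  have p: "Factorial_Ring.prime (int p)" using P.prime by simp
  have p1: "p > 1" using P.prime prime_gt_1_nat by blast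
  have sub: "subgroup zeros G" using solvable_imp_subgroup[OF zeros] .
  have T: "subgroup ?T V" using h.img_is_subgroup by simp
  have cardC: "card ?T * card ?K = card act_kernel"
    using h.card_image_kernel by (simp add: kernel_act_kernel order_def)
  have reduce: "solvable G"
    if A: "A \<in> hom G (GL2 (int p))" "kernel G (GL2 (int p)) A = act_kernel"
      and L: "subgroup (A ` carrier G) (GL2 (int p)) \<Longrightarrow>
        card (A ` carrier G) * card act_kernel = order G \<Longrightarrow> solvable_seq (GL2 (int p)) (A ` carrier G)" for A
  proof -
    interpret A: group_hom G "GL2 (int p)" A
      using A(1) group_GL2[OF p] by (simp add: group_hom_def group_hom_axioms_def)
    show ?thesis
      using A.solvable_of_kernel_and_image solvable_act_kernel[OF zeros] A.img_is_subgroup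
        A.card_image_kernel L by (simp only: A(2))
  qed
  have "carrier V \<noteq> {\<one>\<^bsub>V\<^esub>}"
  proof
    assume "carrier V = {\<one>\<^bsub>V\<^esub>}"
    then have "p\<^sup>2 = 1" using P.order by (simp add: order_def)
    then show False using p1 by (simp add: power2_eq_square)
  qed
  then obtain u where u: "u \<in> carrier V" "u \<noteq> \<one>\<^bsub>V\<^esub>" using V.one_closed by blast
  obtain A where A: "A \<in> hom G (GL2 (int p))" "kernel G (GL2 (int p)) A = act_kernel"
    by (rule matrix_representation[OF pl u]) (rule that)
  have "card ?T dvd p\<^sup>2" using V.card_subgroup_dvd[OF T V.subgroup_self] subgroup.subset[OF T] P.order
    by (simp add: order_def)
  then obtain i where "i \<le> 2" "card ?T = p ^ i" using divides_primepow_nat[OF P.prime] by blast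
  then consider "card ?T = 1" | "card ?T = p" | "card ?T = p\<^sup>2"
    by (metis le_SucE le_zero_eq numeral_2_eq_2 power_0 power_one_right One_nat_def)
  then show ?thesis
  proof cases
    \<comment> \<open>Here \<open>act_kernel\<close> lies in \<open>zeros\<close>, whose index is
      p^2, so p^2 divides the order of the matrix group.\<close>
    case 1
    show ?thesis
    proof (rule reduce[OF A])
      assume L: "subgroup (A ` carrier G) (GL2 (int p))" and c: "card (A ` carrier G) * card act_kernel = order G"
      have "card act_kernel = card ?K" using cardC 1 by simp
      then have "card act_kernel dvd card zeros"
        using card_subgroup_dvd[OF subgroups_Inter_pair[OF act_kernel_subgroup sub] sub] by simp
      then obtain m where "card zeros = card act_kernel * m" by blast
      moreover have "card act_kernel > 0"
        using subgroup.one_closed[OF act_kernel_subgroup] subgroup.subset[OF act_kernel_subgroup] fin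
        by (auto simp: card_gt_0_iff intro: finite_subset)
      ultimately have "card (A ` carrier G) = p\<^sup>2 * m" using c index P.order by simp
      moreover have "card (A ` carrier G) dvd order (GL2 (int p))"
        using group.card_subgroup_dvd[OF group_GL2[OF p] L group.subgroup_self[OF group_GL2[OF p]]]
          subgroup.subset[OF L] by (simp add: order_def)
      ultimately have "p\<^sup>2 dvd order (GL2 (int p))" by (metis dvd_mult_left)
      then show "solvable_seq (GL2 (int p)) (A ` carrier G)"
        using prime_square_not_dvd_GL2[OF P.prime] by blast
    qed
  next
    case 2
    then have "?T \<noteq> {\<one>\<^bsub>V\<^esub>}" using p1 by auto
    then obtain v where vT: "v \<in> ?T" and v1: "v \<noteq> \<one>\<^bsub>V\<^esub>" using subgroup.one_closed[OF T] by blast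
    have v: "v \<in> carrier V" using vT subgroup.subset[OF T] by blast
    have "range (\<lambda>a::int. v [^]\<^bsub>V\<^esub> a) \<subseteq> ?T" using V.subgroup_int_pow_closed[OF T vT] by blast
    moreover have "finite ?T" using finite_subset[OF subgroup.subset[OF T] P.fin] .
    moreover have "card (range (\<lambda>a::int. v [^]\<^bsub>V\<^esub> a)) = card ?T"
      using V.powers_of_prime_order[OF P.prime v P.exponent[OF v] v1] 2 by simp
    ultimately have line: "range (\<lambda>a::int. v [^]\<^bsub>V\<^esub> a) = ?T" using card_subset_eq by blast
    \<comment> \<open>A new basis, starting with a vector on the invariant line \<open>?T\<close>,
      replaces the arbitrary one.\<close>
    obtain A where A: "A \<in> hom G (GL2 (int p))" "kernel G (GL2 (int p)) A = act_kernel"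
      and tri: "\<And>g a b c d. g \<in> carrier G \<Longrightarrow> A g = (a, b, c, d) \<Longrightarrow>
        act g v \<in> range (\<lambda>a::int. v [^]\<^bsub>V\<^esub> a) \<Longrightarrow> c = 0"
      by (rule matrix_representation[OF pl v v1]) (rule that)
    show ?thesis
    proof (rule reduce[OF A])
      assume L: "subgroup (A ` carrier G) (GL2 (int p))"
      show "solvable_seq (GL2 (int p)) (A ` carrier G)"
      proof (rule GL2_triangular_solvable[OF p L])
        fix a b c d assume "(a, b, c, d) \<in> A ` carrier G"
        then obtain g where g: "g \<in> carrier G" and Ag: "A g = (a, b, c, d)" by force
        show "c = 0" using tri[OF g Ag] image_act_kernel_invariant[OF g vT] unfolding line by blast
      qed
    qed
  next
    \<comment> \<open>Now p^2 divides the order of \<open>act_kernel\<close>; another factor p in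
      the matrix group would give p^3 in the order of G.\<close>
    case 3
    show ?thesis
    proof (rule reduce[OF A])
      assume L: "subgroup (A ` carrier G) (GL2 (int p))" and c: "card (A ` carrier G) * card act_kernel = order G"
      let ?l = "card (A ` carrier G)"
      have o: "order G = ?l * (p\<^sup>2 * card ?K)" using c cardC 3 by simp
      show "solvable_seq (GL2 (int p)) (A ` carrier G)"
      proof (rule GL2_regular_subgroup_solvable[OF p L])
        show "\<not> int p dvd int ?l"
        proof
          assume "int p dvd int ?l"
          then obtain m where "?l = p * m" by auto
          then have "p ^ 3 dvd order G" unfolding o by (simp add: power3_eq_cube power2_eq_square)
          then show False using cf P.prime by (auto simp: cube_free_def)
        qed
        show "\<not> 8 dvd ?l"
        proof
          assume "8 dvd ?l"
          then have "2 ^ 3 dvd order G" unfolding o by simp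
          then show False using cf two_is_prime_nat by (metis cube_free_def)
        qed
      qed
    qed
  qed
qed

end

section \<open>Verbal subgroups and crossed bijections\<close>

lemma (in group) cauchy:
  assumes "finite (carrier G)" "Factorial_Ring.prime (q::nat)" "q dvd order G"
  obtains x where "x \<in> carrier G" "x \<noteq> \<one>" "x [^] q = \<one>"
proof -
  \<comment> \<open>\<open>sylow_thm\<close> supplies a subgroup for any prime power dividing the
    order, here with exponent 1 instead of the maximal one.\<close>
  obtain m where "order G = q ^ 1 * m" using assms(3) by auto
  then obtain H where H: "subgroup H G" "card H = q ^ 1"
    using sylow_thm[OF assms(2) is_group] assms(1) by blast
  have "H \<noteq> {\<one>}" using H(2) prime_gt_1_nat[OF assms(2)] by auto
  then obtain x where x: "x \<in> H" "x \<noteq> \<one>" using subgroup.one_closed[OF H(1)] by blast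
  interpret H: group "G\<lparr>carrier := H\<rparr>" using subgroup_imp_group[OF H(1)] .
  have "x [^]\<^bsub>G\<lparr>carrier := H\<rparr>\<^esub> order (G\<lparr>carrier := H\<rparr>) = \<one>"
    using H.pow_order_eq_1[of x] x by simp
  then have "x [^] q = \<one>" using H(2) by (simp add: order_def nat_pow_consistent[symmetric])
  then show ?thesis using that subgroup.mem_carrier[OF H(1) x(1)] x(2) by blast
qed

lemma (in group) order_prime_power:
  assumes "finite (carrier G)" and p: "Factorial_Ring.prime (p::nat)"
    and exp: "\<And>x. x \<in> carrier G \<Longrightarrow> x [^] p = \<one>"
  obtains k where "order G = p ^ k"
proof -
  have "order G > 0" using assms(1) order_gt_0_iff_finite by simp
  then obtain k m where km: "order G = p ^ k * m" "\<not> p dvd m"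
    using prime_power_canonical[OF p] by (metis mult.commute)
  have "m = 1"
  proof (rule ccontr)
    assume "m \<noteq> 1"
    then obtain q where q: "Factorial_Ring.prime q" "q dvd m" using prime_factor_nat by blast
    then have "q dvd order G" using km by simp
    then obtain x where x: "x \<in> carrier G" "x \<noteq> \<one>" "x [^] q = \<one>"
      using cauchy[OF assms(1) q(1)] by blast
    have "p = q" using ord_prime[OF p x(1) exp[OF x(1)] x(2)] ord_prime[OF q(1) x(1,3,2)] by simp
    then show False using q km by simp
  qed
  then show ?thesis using that km by simp
qed

section \<open>Subgroups generated by commutators and p-th powers\<close>

definition verbal_gens :: "('a, 'b) monoid_scheme \<Rightarrow> nat \<Rightarrow> 'a set" where
  "verbal_gens G p = derived_set G (carrier G) \<union> {x [^]\<^bsub>G\<^esub> p | x. x \<in> carrier G}"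

definition verbal :: "('a, 'b) monoid_scheme \<Rightarrow> nat \<Rightarrow> 'a set" where
  "verbal G p = generate G (verbal_gens G p)"

context group
begin

lemma verbal_gens_subset: "verbal_gens G p \<subseteq> carrier G"
  by (auto simp: verbal_gens_def)

lemma verbal_subgroup: "subgroup (verbal G p) G"
  unfolding verbal_def by (rule generate_is_subgroup[OF verbal_gens_subset])

lemma verbal_commutator:
  "x \<in> carrier G \<Longrightarrow> y \<in> carrier G \<Longrightarrow> x \<otimes> y \<otimes> inv x \<otimes> inv y \<in> verbal G p"
  unfolding verbal_def by (rule generate.incl) (auto simp: verbal_gens_def)

lemma verbal_power: "x \<in> carrier G \<Longrightarrow> x [^] p \<in> verbal G p"
  unfolding verbal_def by (rule generate.incl) (auto simp: verbal_gens_def)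

lemma verbal_invariant:
  assumes "f \<in> hom G G" "x \<in> verbal G p"
  shows "f x \<in> verbal G p"
proof -
  interpret f: group_hom G G f using assms(1) by unfold_locales
  have "f ` verbal_gens G p \<subseteq> verbal_gens G p"
  proof
    fix y assume "y \<in> f ` verbal_gens G p"
    then consider a b where "a \<in> carrier G" "b \<in> carrier G" "y = f (a \<otimes> b \<otimes> inv a \<otimes> inv b)"
      | a where "a \<in> carrier G" "y = f (a [^] p)"
      by (auto simp: verbal_gens_def)
    then show "y \<in> verbal_gens G p"
    proof cases
      case 1
      then have "y = f a \<otimes> f b \<otimes> inv (f a) \<otimes> inv (f b)" by simp
      then show ?thesis
        unfolding verbal_gens_def using f.hom_closed[OF 1(1)] f.hom_closed[OF 1(2)] by blast
    next
      case 2
      then have "y = f a [^] p" by (simp add: f.hom_nat_pow)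
      then show ?thesis unfolding verbal_gens_def using f.hom_closed[OF 2(1)] by blast
    qed
  qed
  then have "f ` verbal G p \<subseteq> verbal G p"
    unfolding verbal_def f.generate_img[OF verbal_gens_subset, symmetric] by (rule mono_generate)
  then show ?thesis using assms(2) by blast
qed

lemma verbal_normal: "verbal G p \<lhd> G"
proof -
  have "g \<otimes> x \<otimes> inv g \<in> verbal G p" if "g \<in> carrier G" "x \<in> verbal G p" for g x
  proof -
    have "conjg G g \<in> hom G G" using that(1) by (auto simp: hom_def conjg_mult)
    from verbal_invariant[OF this that(2)] show ?thesis by (simp add: conjg_def)
  qed
  then show ?thesis using verbal_subgroup normal_inv_iff by blast
qed

lemma verbal_quotient_comm_group: "comm_group (G Mod verbal G p)"
proof -
  interpret M: normal "verbal G p" G by (rule verbal_normal)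
  have "verbal G p #> (x \<otimes> y) = verbal G p #> (y \<otimes> x)" if xy: "x \<in> carrier G" "y \<in> carrier G" for x y
  proof (rule repr_independence)
    have "y \<otimes> x = (y \<otimes> x \<otimes> inv y \<otimes> inv x) \<otimes> (x \<otimes> y)" using commutator_mult[OF xy(2,1)] by simp
    then show "y \<otimes> x \<in> verbal G p #> (x \<otimes> y)"
      unfolding r_coset_def using verbal_commutator[OF xy(2,1)] by blast
    show "x \<otimes> y \<in> carrier G" using xy by simp
    show "subgroup (verbal G p) G" by (rule verbal_subgroup)
  qed
  then show ?thesis
    by (intro group.group_comm_groupI M.factorgroup_is_group) (auto simp: carrier_FactGroup M.rcos_sum)
qed

lemma verbal_quotient_exponent:
  assumes "Y \<in> carrier (G Mod verbal G p)"
  shows "Y [^]\<^bsub>G Mod verbal G p\<^esub> p = \<one>\<^bsub>G Mod verbal G p\<^esub>"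
proof -
  interpret M: normal "verbal G p" G by (rule verbal_normal)
  obtain x where x: "x \<in> carrier G" "Y = verbal G p #> x" using assms by (auto simp: carrier_FactGroup)
  then have "Y [^]\<^bsub>G Mod verbal G p\<^esub> p = verbal G p #> (x [^] p)" by (simp add: M.FactGroup_pow)
  then show ?thesis using coset_join2[OF _ verbal_subgroup verbal_power] x by simp
qed

lemma derived_proper:
  assumes "solvable G" "carrier G \<noteq> {\<one>}"
  shows "derived G (carrier G) \<noteq> carrier G"
proof
  assume eq: "derived G (carrier G) = carrier G"
  have "(derived G ^^ n) (carrier G) = carrier G" for n by (induction n) (simp_all add: eq)
  then show False using assms solvable_iff_trivial_derived_seq by auto
qed

text \<open>The abelianization of G is nontrivial. For a prime p dividing its order, Cauchy's
  theorem makes the p-th power map non-injective, hence by finiteness not surjective. The preimage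
  \<open>?P\<close> of its image is a proper subgroup containing all generators.\<close>

lemma verbal_proper:
  assumes fin: "finite (carrier G)" and "solvable G" "carrier G \<noteq> {\<one>}"
  obtains p where "Factorial_Ring.prime p" "verbal G p \<noteq> carrier G"
proof -
  let ?D = "derived G (carrier G)"
  interpret D: normal ?D G by (rule derived_self_is_normal)
  let ?Q = "G Mod ?D"
  interpret Q: comm_group ?Q
    using derived_quot_of_subgroup_is_comm_group[OF subgroup_self] by simp
  have q: "(\<lambda>x. ?D #> x) \<in> hom G ?Q" by (rule D.r_coset_hom_Mod)
  interpret q: group_hom G ?Q "\<lambda>x. ?D #> x" using q by unfold_locales
  have finQ: "finite (carrier ?Q)" using fin by (simp add: carrier_FactGroup)
  have "order ?Q * card ?D = order G" using lagrange[OF D.subgroup_axioms] by (simp add: order_def FactGroup_def)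
  moreover have "card ?D < order G"
    unfolding order_def using derived_proper[OF assms(2,3)] D.subset fin by (intro psubset_card_mono) auto
  ultimately have "order ?Q \<noteq> 1" by auto
  then obtain p where p: "Factorial_Ring.prime p" "p dvd order ?Q" using prime_factor_nat by blast
  obtain Y0 where Y0: "Y0 \<in> carrier ?Q" "Y0 \<noteq> \<one>\<^bsub>?Q\<^esub>" "Y0 [^]\<^bsub>?Q\<^esub> p = \<one>\<^bsub>?Q\<^esub>"
    using Q.cauchy[OF finQ p] by blast
  have pw: "(\<lambda>Y. Y [^]\<^bsub>?Q\<^esub> p) \<in> hom ?Q ?Q" by (rule homI) (assumption | rule Q.nat_pow_closed Q.nat_pow_distrib)+
  interpret pw: group_hom ?Q ?Q "\<lambda>Y. Y [^]\<^bsub>?Q\<^esub> p" using pw by unfold_locales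
  let ?I = "(\<lambda>Y. Y [^]\<^bsub>?Q\<^esub> p) ` carrier ?Q"
  have "\<not> inj_on (\<lambda>Y. Y [^]\<^bsub>?Q\<^esub> p) (carrier ?Q)"
    using Y0 Q.one_closed by (metis (no_types, lifting) Q.nat_pow_one inj_onD)
  then have "?I \<noteq> carrier ?Q" using finQ by (metis eq_card_imp_inj_on)
  then obtain Z where Z: "Z \<in> carrier ?Q" "Z \<notin> ?I" using pw.img_is_subgroup by (auto dest: subgroup.subset)
  then obtain z where z: "z \<in> carrier G" "Z = ?D #> z" by (auto simp: carrier_FactGroup)
  let ?P = "{x \<in> carrier G. ?D #> x \<in> ?I}"
  have P: "subgroup ?P G"
  proof (rule subgroupI)
    show "?P \<subseteq> carrier G" by blast
    have "?D #> \<one> \<in> ?I" using subgroup.one_closed[OF pw.img_is_subgroup] q.hom_one by simp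
    then show "?P \<noteq> {}" by blast
    fix a assume a: "a \<in> ?P"
    then show "inv a \<in> ?P" using subgroup.m_inv_closed[OF pw.img_is_subgroup] q.hom_inv[of a] by auto
    fix b assume b: "b \<in> ?P"
    then show "a \<otimes> b \<in> ?P" using a subgroup.m_closed[OF pw.img_is_subgroup] q.hom_mult[of a b] by auto
  qed
  have "verbal_gens G p \<subseteq> ?P"
  proof
    fix y assume y: "y \<in> verbal_gens G p"
    have yc: "y \<in> carrier G" using y verbal_gens_subset by blast
    have "?D #> y \<in> ?I"
    proof (cases "y \<in> derived_set G (carrier G)")
      case True
      then have "y \<in> ?D" unfolding derived_def by (rule generate.incl)
      then have "?D #> y = \<one>\<^bsub>?Q\<^esub>" using coset_join2[OF yc D.subgroup_axioms] by simp
      then show ?thesis using subgroup.one_closed[OF pw.img_is_subgroup] by simp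
    next
      case False
      then obtain x where x: "x \<in> carrier G" "y = x [^] p" using y by (auto simp: verbal_gens_def)
      then have "?D #> y = (?D #> x) [^]\<^bsub>?Q\<^esub> p" by (simp add: q.hom_nat_pow)
      then show ?thesis using x by (auto simp: carrier_FactGroup)
    qed
    then show "y \<in> ?P" using yc by blast
  qed
  then have "verbal G p \<subseteq> ?P" unfolding verbal_def using generate_subgroup_incl[OF _ P] by blast
  then have "z \<notin> verbal G p" using Z z by blast
  then show ?thesis using that p(1) z(1) by blast
qed

end

section \<open>Crossed bijections and the induction\<close>

text \<open>\<open>\<pi>\<close> is a bijective 1-cocycle. Only homomorphisms are asked of
  \<open>lam\<close>; their invertibility follows from the action laws in
  \<open>lam_inv\<close>.\<close>

locale crossed_bijection = G: group G + N: group N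
  for G (structure) and N (structure) +
  fixes lam :: "'a \<Rightarrow> 'c \<Rightarrow> 'c" and \<pi> :: "'a \<Rightarrow> 'c"
  assumes lam_hom: "g \<in> carrier G \<Longrightarrow> lam g \<in> hom N N"
    and lam_mult: "g \<in> carrier G \<Longrightarrow> h \<in> carrier G \<Longrightarrow> x \<in> carrier N \<Longrightarrow>
          lam (g \<otimes>\<^bsub>G\<^esub> h) x = lam g (lam h x)"
    and lam_one: "x \<in> carrier N \<Longrightarrow> lam \<one>\<^bsub>G\<^esub> x = x"
    and bij: "bij_betw \<pi> (carrier G) (carrier N)"
    and crossed: "g \<in> carrier G \<Longrightarrow> h \<in> carrier G \<Longrightarrow>
          \<pi> (g \<otimes>\<^bsub>G\<^esub> h) = \<pi> g \<otimes>\<^bsub>N\<^esub> lam g (\<pi> h)"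
begin

lemma lam_closed: "g \<in> carrier G \<Longrightarrow> x \<in> carrier N \<Longrightarrow> lam g x \<in> carrier N"
  using lam_hom by (auto simp: hom_def)

lemma pi_closed: "g \<in> carrier G \<Longrightarrow> \<pi> g \<in> carrier N"
  using bij by (auto simp: bij_betw_def)

lemma pi_one: "\<pi> \<one>\<^bsub>G\<^esub> = \<one>\<^bsub>N\<^esub>"
proof -
  have "\<pi> \<one>\<^bsub>G\<^esub> = \<pi> \<one>\<^bsub>G\<^esub> \<otimes>\<^bsub>N\<^esub> \<pi> \<one>\<^bsub>G\<^esub>"
    using crossed[of "\<one>\<^bsub>G\<^esub>" "\<one>\<^bsub>G\<^esub>"] pi_closed by (simp add: lam_one)
  then show ?thesis using pi_closed by (metis G.one_closed N.r_cancel_one')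
qed

lemma lam_inv:
  assumes "g \<in> carrier G" "x \<in> carrier N"
  shows "lam g (lam (inv\<^bsub>G\<^esub> g) x) = x" "lam (inv\<^bsub>G\<^esub> g) (lam g x) = x"
  using assms by (simp_all add: lam_mult[symmetric] lam_one)

lemma order_eq: "order G = order N"
  using bij_betw_same_card[OF bij] by (simp add: order_def)

context
  fixes p assumes p: "Factorial_Ring.prime (p::nat)"
begin

abbreviation "M \<equiv> verbal N p"
abbreviation "H \<equiv> {g \<in> carrier G. \<pi> g \<in> M}"

lemma M_closed: "x \<in> M \<Longrightarrow> x \<in> carrier N"
  using N.verbal_subgroup subgroup.mem_carrier by metis

lemma lam_M: "g \<in> carrier G \<Longrightarrow> x \<in> M \<Longrightarrow> lam g x \<in> M"
  using N.verbal_invariant lam_hom by blast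

text \<open>For inverses, the cocycle identity on g and its inverse determines \<open>\<pi>\<close>
  of the inverse only up to \<open>lam g\<close>. Applying the inverse action recovers it, staying
  in M by \<open>lam_M\<close>.\<close>

lemma H_subgroup: "subgroup H G"
proof (rule G.subgroupI)
  note M = N.verbal_subgroup[of p]
  show "H \<subseteq> carrier G" by blast
  show "H \<noteq> {}" using pi_one subgroup.one_closed[OF M] by auto
  fix g assume g: "g \<in> H"
  then have gc: "g \<in> carrier G" by blast
  have "\<pi> g \<otimes>\<^bsub>N\<^esub> lam g (\<pi> (inv\<^bsub>G\<^esub> g)) = \<one>\<^bsub>N\<^esub>"
    using crossed[of g "inv\<^bsub>G\<^esub> g"] gc pi_one by simp
  then have "lam g (\<pi> (inv\<^bsub>G\<^esub> g)) = inv\<^bsub>N\<^esub> (\<pi> g)"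
    using gc by (metis G.inv_closed N.inv_equality N.inv_inv N.inv_closed lam_closed pi_closed N.inv_comm)
  then have "lam g (\<pi> (inv\<^bsub>G\<^esub> g)) \<in> M" using subgroup.m_inv_closed[OF M] g by simp
  then have "lam (inv\<^bsub>G\<^esub> g) (lam g (\<pi> (inv\<^bsub>G\<^esub> g))) \<in> M" using lam_M gc by simp
  then show "inv\<^bsub>G\<^esub> g \<in> H" using gc by (simp add: lam_inv pi_closed)
  fix h assume h: "h \<in> H"
  then show "g \<otimes>\<^bsub>G\<^esub> h \<in> H" using g crossed[of g h] lam_M subgroup.m_closed[OF M] by auto
qed

lemma restrict: "crossed_bijection (G\<lparr>carrier := H\<rparr>) (N\<lparr>carrier := M\<rparr>) lam \<pi>"
proof (intro crossed_bijection.intro crossed_bijection_axioms.intro)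
  show "group (G\<lparr>carrier := H\<rparr>)" by (rule G.subgroup_imp_group[OF H_subgroup])
  show "group (N\<lparr>carrier := M\<rparr>)" by (rule N.subgroup_imp_group[OF N.verbal_subgroup])
  show "lam g \<in> hom (N\<lparr>carrier := M\<rparr>) (N\<lparr>carrier := M\<rparr>)" if "g \<in> carrier (G\<lparr>carrier := H\<rparr>)" for g
    using that lam_M lam_hom M_closed by (auto simp: hom_def)
  show "bij_betw \<pi> (carrier (G\<lparr>carrier := H\<rparr>)) (carrier (N\<lparr>carrier := M\<rparr>))"
    using bij M_closed by (auto simp: bij_betw_def inj_on_def)
qed (auto simp: lam_mult lam_one crossed M_closed)

lemma lam_coset:
  assumes g: "g \<in> carrier G" and x: "x \<in> carrier N"
  shows "lam g ` (M #>\<^bsub>N\<^esub> x) = M #>\<^bsub>N\<^esub> lam g x"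
proof -
  have "lam g (m \<otimes>\<^bsub>N\<^esub> x) = lam g m \<otimes>\<^bsub>N\<^esub> lam g x" if "m \<in> M" for m
    using lam_hom[OF g] M_closed[OF that] x by (auto simp: hom_def)
  moreover have "\<exists>m'\<in>M. m = lam g m'" if "m \<in> M" for m
    using that lam_M[of "inv\<^bsub>G\<^esub> g" m] lam_inv(1)[OF g] M_closed g by (metis G.inv_closed)
  ultimately show ?thesis
    using lam_M[OF g] unfolding r_coset_def by (auto simp: image_iff) metis+
qed

lemma quotient_crossed_hom:
  "crossed_hom G (N Mod M) (\<lambda>g Y. lam g ` Y) (\<lambda>g. M #>\<^bsub>N\<^esub> \<pi> g)"
proof -
  interpret V: comm_group "N Mod M" by (rule N.verbal_quotient_comm_group)
  interpret M: normal M N by (rule N.verbal_normal)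
  have carr: "\<exists>x\<in>carrier N. Y = M #>\<^bsub>N\<^esub> x" if "Y \<in> carrier (N Mod M)" for Y
    using that by (auto simp: carrier_FactGroup)
  show ?thesis
  proof (intro crossed_hom.intro crossed_hom_axioms.intro group_action_by_homs.intro
      group_action_by_homs_axioms.intro)
    show "group G" "comm_group (N Mod M)" by unfold_locales
    show "(\<lambda>Y. lam g ` Y) \<in> hom (N Mod M) (N Mod M)" if g: "g \<in> carrier G" for g
    proof (rule homI)
      fix Y assume "Y \<in> carrier (N Mod M)"
      then obtain x where x: "x \<in> carrier N" "Y = M #>\<^bsub>N\<^esub> x" using carr by blast
      then show "lam g ` Y \<in> carrier (N Mod M)"
        using g by (simp add: lam_coset carrier_FactGroup lam_closed)
      fix Z assume "Z \<in> carrier (N Mod M)"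
      then obtain y where y: "y \<in> carrier N" "Z = M #>\<^bsub>N\<^esub> y" using carr by blast
      show "lam g ` (Y \<otimes>\<^bsub>N Mod M\<^esub> Z) = lam g ` Y \<otimes>\<^bsub>N Mod M\<^esub> lam g ` Z"
        using g x y hom_mult[OF lam_hom[OF g]] by (simp add: lam_coset lam_closed M.rcos_sum)
    qed
    show "lam (g \<otimes>\<^bsub>G\<^esub> h) ` Y = lam g ` lam h ` Y"
      if gh: "g \<in> carrier G" "h \<in> carrier G" and Y: "Y \<in> carrier (N Mod M)" for g h Y
    proof -
      obtain x where "x \<in> carrier N" "Y = M #>\<^bsub>N\<^esub> x" using carr[OF Y] by blast
      then show ?thesis using gh by (simp add: lam_coset lam_mult lam_closed)
    qed
    show "lam \<one>\<^bsub>G\<^esub> ` Y = Y" if Y: "Y \<in> carrier (N Mod M)" for Y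
    proof -
      obtain x where "x \<in> carrier N" "Y = M #>\<^bsub>N\<^esub> x" using carr[OF Y] by blast
      then show ?thesis by (simp add: lam_coset lam_one)
    qed
    show "M #>\<^bsub>N\<^esub> \<pi> g \<in> carrier (N Mod M)" if "g \<in> carrier G" for g
      using that pi_closed by (auto simp: carrier_FactGroup)
    show "M #>\<^bsub>N\<^esub> \<pi> (g \<otimes>\<^bsub>G\<^esub> h) = (M #>\<^bsub>N\<^esub> \<pi> g) \<otimes>\<^bsub>N Mod M\<^esub> lam g ` (M #>\<^bsub>N\<^esub> \<pi> h)"
      if "g \<in> carrier G" "h \<in> carrier G" for g h
      using that by (simp add: crossed lam_coset pi_closed lam_closed M.rcos_sum)
  qed
qed

lemma quotient_step:
  assumes fin: "finite (carrier N)" and cf: "cube_free (order N)" and proper: "M \<noteq> carrier N"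
    and H: "solvable_seq G H"
  shows "solvable G"
proof -
  interpret V: comm_group "N Mod M" by (rule N.verbal_quotient_comm_group)
  interpret c: crossed_hom G "N Mod M" "\<lambda>g Y. lam g ` Y" "\<lambda>g. M #>\<^bsub>N\<^esub> \<pi> g"
    by (rule quotient_crossed_hom)
  have "M #>\<^bsub>N\<^esub> x = M \<longleftrightarrow> x \<in> M" if "x \<in> carrier N" for x
    using N.coset_join1[OF _ that N.verbal_subgroup] N.coset_join2[OF that N.verbal_subgroup] by blast
  then have zeros: "c.zeros = H" using pi_closed by (auto simp: c.zeros_def)
  have finV: "finite (carrier (N Mod M))" using fin by (simp add: carrier_FactGroup)
  have lag: "order (N Mod M) * card M = order N"
    using N.lagrange[OF N.verbal_subgroup] by (simp add: order_def FactGroup_def)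
  \<comment> \<open>Although \<open>H\<close> need not be normal, the bijection turns the order of
    N/M into its index, as required by \<open>solvable_plane\<close>.\<close>
  have "card H = card M"
    using bij_betw_same_card[OF crossed_bijection.bij[OF restrict]] by simp
  then have index: "order G = order (N Mod M) * card c.zeros" using lag zeros order_eq by simp
  have exp: "Y [^]\<^bsub>N Mod M\<^esub> p = \<one>\<^bsub>N Mod M\<^esub>" if "Y \<in> carrier (N Mod M)" for Y
    using N.verbal_quotient_exponent that by blast
  obtain k where k: "order (N Mod M) = p ^ k" using V.order_prime_power[OF finV p exp] by blast
  have "k \<noteq> 0"
  proof
    assume "k = 0"
    then have "card M = card (carrier N)" using k lag by (simp add: order_def)
    then show False using proper card_subset_eq[OF fin, of M] M_closed by blast
  qed
  moreover have "k < 3"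
  proof (rule ccontr)
    assume "\<not> k < 3"
    then have "p ^ 3 dvd order N" using lag k by (metis dvd_mult2 dvd_refl le_imp_power_dvd not_less)
    then show False using cf p by (auto simp: cube_free_def)
  qed
  ultimately consider "k = 1" | "k = 2" by linarith
  then show ?thesis
  proof cases
    case 1
    then show ?thesis using c.solvable_cyclic_plane[OF p] k H zeros by simp
  next
    case 2
    have "prime_plane (N Mod M) p"
      by unfold_locales (use p exp finV k 2 in auto)
    moreover have "finite (carrier G)" using bij fin bij_betw_finite by blast
    ultimately show ?thesis using c.solvable_plane cf order_eq index H zeros by simp
  qed
qed

end

end

theorem crossed_bijection_solvable:
  assumes "crossed_bijection G N lam \<pi>" "finite (carrier N)" "cube_free (order N)" "solvable N"
  shows "solvable G"
  using assms
\<comment> \<open>Restriction leaves \<open>lam\<close> and \<open>\<pi>\<close> unchanged as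
  functions, so only G and N vary.\<close>
proof (induction "order N" arbitrary: G N rule: less_induct)
  case less
  interpret crossed_bijection G N lam \<pi> by fact
  show ?case
  proof (cases "carrier N = {\<one>\<^bsub>N\<^esub>}")
    case True
    then have "card (carrier G) = 1" using order_eq by (simp add: order_def)
    then obtain a where "carrier G = {a}" by (auto simp: card_1_singleton_iff)
    then show ?thesis
      unfolding solvable_def by (intro G.commuting_imp_solvable_seq G.subgroup_self) auto
  next
    case False
    then obtain p where p: "Factorial_Ring.prime p" and proper: "verbal N p \<noteq> carrier N"
      using N.verbal_proper less.prems by blast
    let ?M = "verbal N p" and ?H = "{g \<in> carrier G. \<pi> g \<in> verbal N p}"
    have MN: "?M \<subseteq> carrier N" using subgroup.subset[OF N.verbal_subgroup] .
    have "card ?M dvd order N" using N.lagrange[OF N.verbal_subgroup] by (metis dvd_triv_right)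
    then have "cube_free (card ?M)"
      using less.prems(3) dvd_trans unfolding cube_free_def by blast
    moreover have "card ?M < order N"
      unfolding order_def using MN proper less.prems(2) by (intro psubset_card_mono) auto
    moreover have "solvable (N\<lparr>carrier := ?M\<rparr>)"
      using N.solvable_subgroup_iff N.solvable_subgroup N.verbal_subgroup less.prems(4) by blast
    moreover have "finite ?M" using finite_subset[OF MN less.prems(2)] .
    ultimately have "solvable (G\<lparr>carrier := ?H\<rparr>)"
      using less.hyps[OF _ restrict[OF p]] by (simp add: order_def)
    then have "solvable_seq G ?H" using G.solvable_subgroup_iff[OF H_subgroup[OF p]] by blast
    then show ?thesis using quotient_step[OF p less.prems(2,3) proper] by blast
  qed
qed

section \<open>From regular subgroups of the holomorph to crossed bijections\<close>

text \<open>If \<open>\<sigma>\<close> is \<open>\<alpha>\<close> followed by right multiplication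
  by \<open>\<eta>\<close>^-1, then \<open>\<sigma>\<close> sends 1 to \<open>\<eta>\<close>^-1, and
  the action of \<open>\<sigma>\<close> is \<open>\<alpha>\<close> followed by conjugation by
  \<open>\<eta>\<close>, a homomorphism. Regularity is precisely bijectivity of the evaluation at
  1.\<close>

lemma regular_subgroup_crossed_bijection:
  assumes N: "group N" and Hol: "\<G> \<subseteq> Hol N" and reg: "regular_perm_subgroup N \<G>"
  shows "crossed_bijection (BijGroup (carrier N)\<lparr>carrier := \<G>\<rparr>) N
    (\<lambda>\<sigma> x. inv\<^bsub>N\<^esub> (\<sigma> \<one>\<^bsub>N\<^esub>) \<otimes>\<^bsub>N\<^esub> \<sigma> x) (\<lambda>\<sigma>. \<sigma> \<one>\<^bsub>N\<^esub>)"
proof -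
  interpret N: group N by fact
  let ?B = "BijGroup (carrier N)"
  have sub: "subgroup \<G> ?B" and bij: "bij_betw (\<lambda>\<sigma>. \<sigma> \<one>\<^bsub>N\<^esub>) \<G> (carrier N)"
    using reg by (auto simp: regular_perm_subgroup_def)
  have Bij: "\<sigma> \<in> Bij (carrier N)" if "\<sigma> \<in> \<G>" for \<sigma>
    using subgroup.mem_carrier[OF sub that] by (simp add: BijGroup_def)
  have closed: "\<sigma> x \<in> carrier N" if "\<sigma> \<in> \<G>" "x \<in> carrier N" for \<sigma> x
    using Bij[OF that(1)] that(2) Bij_imp_funcset by blast
  have mult: "(\<sigma> \<otimes>\<^bsub>?B\<^esub> \<tau>) x = \<sigma> (\<tau> x)" if "\<sigma> \<in> \<G>" "\<tau> \<in> \<G>" "x \<in> carrier N" for \<sigma> \<tau> x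
    using Bij[OF that(1)] Bij[OF that(2)] that(3) by (simp add: BijGroup_def compose_def)
  have hom: "inv\<^bsub>N\<^esub> (\<sigma> \<one>\<^bsub>N\<^esub>) \<otimes>\<^bsub>N\<^esub> \<sigma> (x \<otimes>\<^bsub>N\<^esub> y) =
      (inv\<^bsub>N\<^esub> (\<sigma> \<one>\<^bsub>N\<^esub>) \<otimes>\<^bsub>N\<^esub> \<sigma> x) \<otimes>\<^bsub>N\<^esub> (inv\<^bsub>N\<^esub> (\<sigma> \<one>\<^bsub>N\<^esub>) \<otimes>\<^bsub>N\<^esub> \<sigma> y)"
    if \<sigma>: "\<sigma> \<in> \<G>" and xy: "x \<in> carrier N" "y \<in> carrier N" for \<sigma> x y
  proof -
    obtain \<eta> \<alpha> where \<eta>: "\<eta> \<in> carrier N" and \<alpha>: "\<alpha> \<in> auto N"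
      and \<sigma>_eq: "\<sigma> = compose (carrier N) (rho_perm N \<eta>) \<alpha>"
      using Hol \<sigma> by (auto simp: Hol_def)
    interpret \<alpha>: group_hom N N \<alpha> using \<alpha> by unfold_locales (simp add: auto_def)
    have *: "\<sigma> z = \<alpha> z \<otimes>\<^bsub>N\<^esub> inv\<^bsub>N\<^esub> \<eta>" if "z \<in> carrier N" for z
      using that by (simp add: \<sigma>_eq compose_def rho_perm_def)
    have "inv\<^bsub>N\<^esub> \<eta> \<otimes>\<^bsub>N\<^esub> (\<eta> \<otimes>\<^bsub>N\<^esub> z) = z" if "z \<in> carrier N" for z
      using that \<eta> by (simp add: N.m_assoc[symmetric])
    then show ?thesis using xy \<eta> by (simp add: * N.inv_mult_group N.m_assoc)
  qed
  have factor: "\<sigma> x = \<sigma> \<one>\<^bsub>N\<^esub> \<otimes>\<^bsub>N\<^esub> (inv\<^bsub>N\<^esub> (\<sigma> \<one>\<^bsub>N\<^esub>) \<otimes>\<^bsub>N\<^esub> \<sigma> x)" if "\<sigma> \<in> \<G>" "x \<in> carrier N" for \<sigma> x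
    using closed that by (simp add: N.m_assoc[symmetric])
  show ?thesis
  proof (intro crossed_bijection.intro crossed_bijection_axioms.intro)
    show "group (?B\<lparr>carrier := \<G>\<rparr>)" using group.subgroup_imp_group[OF group_BijGroup sub] .
    show "group N" by fact
    fix \<sigma> assume "\<sigma> \<in> carrier (?B\<lparr>carrier := \<G>\<rparr>)"
    then have \<sigma>: "\<sigma> \<in> \<G>" by simp
    show "(\<lambda>x. inv\<^bsub>N\<^esub> (\<sigma> \<one>\<^bsub>N\<^esub>) \<otimes>\<^bsub>N\<^esub> \<sigma> x) \<in> hom N N"
      using hom[OF \<sigma>] closed[OF \<sigma>] by (intro homI) auto
    fix \<tau> assume "\<tau> \<in> carrier (?B\<lparr>carrier := \<G>\<rparr>)"
    then have \<tau>: "\<tau> \<in> \<G>" by simp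
    show crossed: "(\<sigma> \<otimes>\<^bsub>?B\<lparr>carrier := \<G>\<rparr>\<^esub> \<tau>) \<one>\<^bsub>N\<^esub> =
        \<sigma> \<one>\<^bsub>N\<^esub> \<otimes>\<^bsub>N\<^esub> (inv\<^bsub>N\<^esub> (\<sigma> \<one>\<^bsub>N\<^esub>) \<otimes>\<^bsub>N\<^esub> \<sigma> (\<tau> \<one>\<^bsub>N\<^esub>))"
      using mult[OF \<sigma> \<tau>] factor[OF \<sigma> closed[OF \<tau>]] by simp
    fix x assume x: "x \<in> carrier N"
    \<comment> \<open>y is the image of x under the action of \<open>\<tau>\<close>, so
      \<open>\<tau> x\<close> is \<open>\<tau> 1\<close> times y. Multiplicativity of the action of
      \<open>\<sigma>\<close> on this product gives compatibility with composition.\<close>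
    define y where "y = inv\<^bsub>N\<^esub> (\<tau> \<one>\<^bsub>N\<^esub>) \<otimes>\<^bsub>N\<^esub> \<tau> x"
    have y: "y \<in> carrier N" using closed[OF \<tau>] x by (simp add: y_def)
    have "\<tau> \<one>\<^bsub>N\<^esub> \<otimes>\<^bsub>N\<^esub> y = \<tau> x" using factor[OF \<tau> x] by (simp add: y_def)
    then have "inv\<^bsub>N\<^esub> (\<sigma> \<one>\<^bsub>N\<^esub>) \<otimes>\<^bsub>N\<^esub> \<sigma> (\<tau> x) =
        (inv\<^bsub>N\<^esub> (\<sigma> \<one>\<^bsub>N\<^esub>) \<otimes>\<^bsub>N\<^esub> \<sigma> (\<tau> \<one>\<^bsub>N\<^esub>)) \<otimes>\<^bsub>N\<^esub> (inv\<^bsub>N\<^esub> (\<sigma> \<one>\<^bsub>N\<^esub>) \<otimes>\<^bsub>N\<^esub> \<sigma> y)"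
      using hom[OF \<sigma> closed[OF \<tau> N.one_closed] y] by simp
    then have "inv\<^bsub>N\<^esub> (\<sigma> \<one>\<^bsub>N\<^esub>) \<otimes>\<^bsub>N\<^esub> \<sigma> (\<tau> x) =
        inv\<^bsub>N\<^esub> (\<sigma> \<one>\<^bsub>N\<^esub>) \<otimes>\<^bsub>N\<^esub> (\<sigma> (\<tau> \<one>\<^bsub>N\<^esub>) \<otimes>\<^bsub>N\<^esub> (inv\<^bsub>N\<^esub> (\<sigma> \<one>\<^bsub>N\<^esub>) \<otimes>\<^bsub>N\<^esub> \<sigma> y))"
      using closed[OF \<sigma>] closed[OF \<tau>] x y by (simp only: N.m_assoc N.inv_closed N.m_closed N.one_closed)
    then have "\<sigma> (\<tau> x) = \<sigma> (\<tau> \<one>\<^bsub>N\<^esub>) \<otimes>\<^bsub>N\<^esub> (inv\<^bsub>N\<^esub> (\<sigma> \<one>\<^bsub>N\<^esub>) \<otimes>\<^bsub>N\<^esub> \<sigma> y)"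
      using closed[OF \<sigma>] closed[OF \<tau>] x y by simp
    then have "inv\<^bsub>N\<^esub> (\<sigma> (\<tau> \<one>\<^bsub>N\<^esub>)) \<otimes>\<^bsub>N\<^esub> \<sigma> (\<tau> x) = inv\<^bsub>N\<^esub> (\<sigma> \<one>\<^bsub>N\<^esub>) \<otimes>\<^bsub>N\<^esub> \<sigma> y"
      using closed[OF \<sigma>] closed[OF \<tau>] x y by (simp add: N.m_assoc[symmetric])
    then show "inv\<^bsub>N\<^esub> ((\<sigma> \<otimes>\<^bsub>?B\<lparr>carrier := \<G>\<rparr>\<^esub> \<tau>) \<one>\<^bsub>N\<^esub>) \<otimes>\<^bsub>N\<^esub> (\<sigma> \<otimes>\<^bsub>?B\<lparr>carrier := \<G>\<rparr>\<^esub> \<tau>) x =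
        inv\<^bsub>N\<^esub> (\<sigma> \<one>\<^bsub>N\<^esub>) \<otimes>\<^bsub>N\<^esub> \<sigma> (inv\<^bsub>N\<^esub> (\<tau> \<one>\<^bsub>N\<^esub>) \<otimes>\<^bsub>N\<^esub> \<tau> x)"
      using mult[OF \<sigma> \<tau>] x by (simp add: y_def)
  next
    show "inv\<^bsub>N\<^esub> (\<one>\<^bsub>?B\<lparr>carrier := \<G>\<rparr>\<^esub> \<one>\<^bsub>N\<^esub>) \<otimes>\<^bsub>N\<^esub> \<one>\<^bsub>?B\<lparr>carrier := \<G>\<rparr>\<^esub> x = x" if "x \<in> carrier N" for x
      using that by (simp add: BijGroup_def)
    show "bij_betw (\<lambda>\<sigma>. \<sigma> \<one>\<^bsub>N\<^esub>) (carrier (?B\<lparr>carrier := \<G>\<rparr>)) (carrier N)" using bij by simp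
  qed
qed

theorem theorem1p6:
  fixes n :: nat
    and G :: "('a, 'b) monoid_scheme"
    and N :: "('c, 'd) monoid_scheme"
  assumes "n > 0" and "cube_free n"
    and "group G" and "finite (carrier G)" and "order G = n"
    and "group N" and "finite (carrier N)" and "order N = n"
    and "\<not> solvable G" and "solvable N"
  shows "E' G N = {}"
proof (rule ccontr)
  assume "E' G N \<noteq> {}"
  then obtain \<G> where Hol: "\<G> \<subseteq> Hol N" and reg: "regular_perm_subgroup N \<G>"
    and iso: "G \<cong> BijGroup (carrier N)\<lparr>carrier := \<G>\<rparr>"
    unfolding E'_def by blast
  let ?P = "BijGroup (carrier N)\<lparr>carrier := \<G>\<rparr>"
  note cb = regular_subgroup_crossed_bijection[OF \<open>group N\<close> Hol reg]
  have "solvable ?P"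
    using crossed_bijection_solvable[OF cb] assms by simp
  moreover obtain f where f: "f \<in> iso G ?P" using iso by (auto simp: is_iso_def)
  moreover have "group_hom G ?P f"
    using f \<open>group G\<close> crossed_bijection.axioms(1)[OF cb]
    by (simp add: group_hom_def group_hom_axioms_def iso_def)
  ultimately have "solvable G"
    using group_hom.inj_hom_imp_solvable by (auto simp: iso_def bij_betw_def)
  then show False using assms by blast
qed

end
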